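(* Let $0\leq\alpha\leq\rho$, $\rho>0$, $0<\gamma<\sigma\leq 1$, $\delta\in\{-1,1\}$, $p>1$ and $\frac1p+\frac1q=1$. Let $f\ge 0$ be a function on $\mathbf{R}_+$ and $a=\{a_n\}_{n=1}^\infty$ a sequence with $a_n\geq 0$, such that $0<\|f\|_{p,\Phi_\delta}<\infty$ and $0<\|a\|_{q,\widetilde\Psi}<\infty$. Then the following equivalent inequalities hold: $$I:=\sum_{n=1}^{\infty}\int_0^\infty H_\delta(x,n)\,a_nf(x)\,dx<k(\sigma)\|f\|_{p,\Phi_\delta}\|a\|_{q,\widetilde\Psi},$$ $$J_1:=\left\{\sum_{n=1}^\infty\frac{\nu_n}{\widetilde V_n^{1-p\sigma}}\left[\int_0^\infty H_\delta(x,n)f(x)\,dx\right]^p\right\}^{\frac1p}<k(\sigma)\|f\|_{p,\Phi_\delta},$$ $$J_2:=\left\{\int_0^\infty\frac{\mu(x)}{U^{1-q\delta\sigma}(x)}\left[\sum_{n=1}^\infty H_\delta(x,n)a_n\right]^q dx\right\}^{\frac1q}<k(\sigma)\|a\|_{q,\widetilde\Psi}.$$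
   Context: $\mathbf{N}=\{1,2,\dots\}$, $\mathbf{R}_+=(0,\infty)$. $\nu_n>0$ ($n\in\mathbf N$) are given reals, $V_n:=\sum_{j=1}^n\nu_j$, $\widetilde\nu_n\in[0,\frac{\nu_n}{2}]$, $\widetilde V_n:=V_n-\widetilde\nu_n$. $\mu$ is a positive continuous function on $\mathbf R_+$ with $U(x):=\int_0^x\mu(t)\,dt<\infty$ for $x\in[0,\infty)$. Powers such as $U^{s}(x)$ mean $(U(x))^{s}$. Functions are assumed measurable. $\operatorname{csch}(u):=\frac{2}{e^u-e^{-u}}$ for $u>0$. The kernel is $$H_\delta(x,n):=\frac{\operatorname{csch}\big(\rho(U^\delta(x)\widetilde V_n)^\gamma\big)}{e^{\alpha(U^\delta(x)\widetilde V_n)^\gamma}}.$$ $\Phi_\delta(x):=\frac{U^{p(1-\delta\sigma)-1}(x)}{\mu^{p-1}(x)}$, $\widetilde\Psi(n):=\frac{\widetilde V_n^{q(1-\sigma)-1}}{\nu_n^{q-1}}$, $\|f\|_{p,\Phi_\delta}:=\left(\int_0^\infty\Phi_\delta(x)f^p(x)\,dx\right)^{1/p}$, $\|a\|_{q,\widetilde\Psi}:=\left(\sum_{n=1}^\infty\widetilde\Psi(n)a_n^q\right)^{1/q}$. $$k(\sigma):=\int_0^\infty\frac{\operatorname{csch}(\rho t^\gamma)}{e^{\alpha t^\gamma}}t^{\sigma-1}dt=\frac{2\Gamma(\frac\sigma\gamma)}{\gamma(2\rho)^{\sigma/\gamma}}\zeta\Big(\frac\sigma\gamma,\frac{\alpha+\rho}{2\rho}\Big),$$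 where $\zeta(s,a):=\sum_{k=0}^\infty\frac1{(k+a)^s}$ ($s>1$, $0<a\le1$) is the Hurwitz zeta function and $\Gamma$ is the Gamma function. *)

theory Defs
  imports "HOL-Analysis.Analysis"
begin

text \<open>
  All quantities built from nonnegative functions (norms, sums, integrals) live in
  \<^typ>\<open>ennreal\<close>, so that they are meaningful without any convergence assumption and
  \<open>X < Y\<close> includes the assertion that \<open>X\<close> is finite. Sequences indexed by
  \<open>{1,2,\<dots>}\<close> are functions on \<^typ>\<open>nat\<close> whose value at \<open>0\<close> is never used.
\<close>

text \<open>Real power on \<open>[0,\<infinity>]\<close>, intended for positive exponents only.\<close>

definition epowr :: "ennreal \<Rightarrow> real \<Rightarrow> ennreal" where
  "epowr x s = (if x = \<infinity> then \<infinity> else ennreal (enn2real x powr s))"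

definition csch :: "real \<Rightarrow> real" where
  "csch u = 2 / (exp u - exp (- u))"

definition U :: "(real \<Rightarrow> real) \<Rightarrow> real \<Rightarrow> real" where
  "U \<mu> x = integral\<^sup>L (lebesgue_on {0<..x}) \<mu>"

definition V :: "(nat \<Rightarrow> real) \<Rightarrow> nat \<Rightarrow> real" where
  "V \<nu> n = (\<Sum>j=1..n. \<nu> j)"

text \<open>The argument \<open>\<nu>t\<close> below is the shift sequence \<open>\<nu>\<close>-tilde.\<close>

definition Vt :: "(nat \<Rightarrow> real) \<Rightarrow> (nat \<Rightarrow> real) \<Rightarrow> nat \<Rightarrow> real" where
  "Vt \<nu> \<nu>t n = V \<nu> n - \<nu>t n"

definition H ::
  "real \<Rightarrow> real \<Rightarrow> real \<Rightarrow> real \<Rightarrow> (real \<Rightarrow> real) \<Rightarrow> (nat \<Rightarrow> real) \<Rightarrow> (nat \<Rightarrow> real)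
    \<Rightarrow> real \<Rightarrow> nat \<Rightarrow> real" where
  "H \<alpha> \<rho> \<gamma> \<delta> \<mu> \<nu> \<nu>t x n =
     csch (\<rho> * (U \<mu> x powr \<delta> * Vt \<nu> \<nu>t n) powr \<gamma>)
       / exp (\<alpha> * (U \<mu> x powr \<delta> * Vt \<nu> \<nu>t n) powr \<gamma>)"

definition \<Phi> :: "real \<Rightarrow> real \<Rightarrow> real \<Rightarrow> (real \<Rightarrow> real) \<Rightarrow> real \<Rightarrow> real" where
  "\<Phi> p \<sigma> \<delta> \<mu> x = U \<mu> x powr (p * (1 - \<delta> * \<sigma>) - 1) / \<mu> x powr (p - 1)"

definition \<Psi>t ::
  "real \<Rightarrow> real \<Rightarrow> (nat \<Rightarrow> real) \<Rightarrow> (nat \<Rightarrow> real) \<Rightarrow> nat \<Rightarrow> real" where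
  "\<Psi>t q \<sigma> \<nu> \<nu>t n = Vt \<nu> \<nu>t n powr (q * (1 - \<sigma>) - 1) / \<nu> n powr (q - 1)"

definition wnorm_fun :: "real \<Rightarrow> (real \<Rightarrow> real) \<Rightarrow> (real \<Rightarrow> real) \<Rightarrow> ennreal" where
  "wnorm_fun p w f = epowr (\<integral>\<^sup>+x. ennreal (w x * f x powr p) \<partial>lebesgue_on {0<..}) (1 / p)"

definition wnorm_seq :: "real \<Rightarrow> (nat \<Rightarrow> real) \<Rightarrow> (nat \<Rightarrow> real) \<Rightarrow> ennreal" where
  "wnorm_seq q w a = epowr (\<Sum>n. ennreal (w (Suc n) * a (Suc n) powr q)) (1 / q)"

definition k :: "real \<Rightarrow> real \<Rightarrow> real \<Rightarrow> real \<Rightarrow> ennreal" where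
  "k \<alpha> \<rho> \<gamma> \<sigma> =
     (\<integral>\<^sup>+t. ennreal (csch (\<rho> * t powr \<gamma>) / exp (\<alpha> * t powr \<gamma>) * t powr (\<sigma> - 1))
        \<partial>lebesgue_on {0<..})"

end

theory Submission
  imports Defs
begin

text \<open>
  Put \<open>h t = csch (\<rho> t powr \<gamma>) / exp (\<alpha> t powr \<gamma>)\<close>, so that \<open>H x n = h (U(x) powr \<delta> \<cdot> Vt n)\<close>.
  The weights in the norms are the ones for which the problem becomes scale invariant: with respect
  to the measure \<open>M = \<mu> / U dx\<close> on the half-line and the measure \<open>N\<close> on the positive integers with
  masses \<open>\<nu> n / Vt n\<close>, and for
  \<open>F = f \<cdot> U powr (1 - \<delta> \<sigma>) / \<mu>\<close> and \<open>G n = a n \<cdot> Vt n powr (1 - \<sigma>) / \<nu> n\<close>, the two norms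
  are the plain norms of \<open>F\<close> in \<open>L\<^sup>p(M)\<close> and of \<open>G\<close> in \<open>L\<^sup>q(N)\<close>, and the kernel becomes
  \<open>L x n = h t \<cdot> t powr \<sigma>\<close> with \<open>t = U(x) powr \<delta> \<cdot> Vt n\<close>. Then \<open>J\<^sub>1\<close> and \<open>J\<^sub>2\<close> are the
  norms of the integral transforms of \<open>F\<close> and \<open>G\<close> with kernel \<open>L\<close>.

  A Schur test (\<open>Schur_test_strict\<close>) reduces both estimates to the marginals of \<open>L\<close>. Integrating over
  \<open>x\<close> and substituting \<open>t\<close> gives at most \<open>k \<sigma>\<close> (\<open>nn_integral_profile_le_k\<close>). Summing over \<open>n\<close>
  gives a sampled sum for the integral \<open>k \<sigma>\<close> of \<open>\<phi> t = h t \<cdot> t powr (\<sigma> - 1)\<close>, with intervals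
  of length proportional to \<open>\<nu> n\<close> and sampling points at or to the right of their midpoints. For a
  decreasing, strictly convex \<open>\<phi>\<close> the midpoint rule underestimates every interval strictly
  (\<open>midpoint_less_nn_integral\<close>), so this marginal is strictly below \<open>k \<sigma>\<close>
  (\<open>suminf_profile_less\<close>). Convexity of \<open>\<phi>\<close> comes from log-convexity, which can be checked factor by
  factor and for \<open>csch\<close> is an identity for \<open>sinh\<close> (\<open>weighted_profile_midpoint_log_convex\<close>).

  As this one marginal is strict, so are the bounds for \<open>J\<^sub>1\<close> and \<open>J\<^sub>2\<close>, and the bound for
  \<open>I\<close> follows from that for \<open>J\<^sub>1\<close> by Hoelder's inequality.
\<close>

section \<open>Real powers on the extended half-line\<close>

lemma epowr_ennreal: "x \<ge> 0 \<Longrightarrow> epowr (ennreal x) s = ennreal (x powr s)"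
  by (simp add: epowr_def)

lemma epowr_top [simp]: "epowr top s = top"
  by (simp add: epowr_def)

lemma epowr_zero [simp]: "epowr 0 s = 0"
  by (simp add: epowr_def)

lemma epowr_one [simp]: "epowr x 1 = x"
  by (cases x) (auto simp: epowr_def)

lemma epowr_eq_0_iff [simp]: "epowr x s = 0 \<longleftrightarrow> x = 0"
  by (cases x) (auto simp: epowr_def)

lemma epowr_eq_top_iff [simp]: "epowr x s = top \<longleftrightarrow> x = top"
  by (cases x) (auto simp: epowr_def)

lemma epowr_mult:
  assumes "s > 0" shows "epowr (x * y) s = epowr x s * epowr y s"
proof (cases "x = top \<or> y = top")
  case True
  then show ?thesis
    using assms by (cases "x = 0 \<or> y = 0") (auto simp: ennreal_mult_top ennreal_top_mult)
next
  case False
  then show ?thesis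
    by (cases x; cases y) (auto simp: epowr_ennreal powr_mult simp flip: ennreal_mult)
qed

lemma epowr_epowr: "epowr (epowr x s) t = epowr x (s * t)"
  by (cases x) (auto simp: epowr_ennreal powr_powr)

lemma epowr_add:
  assumes "s > 0" "t > 0" shows "epowr x (s + t) = epowr x s * epowr x t"
  using assms by (cases x) (auto simp: epowr_ennreal powr_add simp flip: ennreal_mult)

lemma epowr_mono:
  assumes "x \<le> y" "s > 0" shows "epowr x s \<le> epowr y s"
  using assms by (cases x; cases y) (auto simp: epowr_ennreal powr_mono2 ennreal_leI top_unique)

lemma epowr_strict_mono:
  assumes "x < y" "s > 0" shows "epowr x s < epowr y s"
  using assms
  by (cases x; cases y) (auto simp: epowr_ennreal powr_less_mono2 ennreal_less_iff)

lemma borel_measurable_epowr [measurable (raw)]: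
  assumes [measurable]: "f \<in> borel_measurable M"
  shows "(\<lambda>x. epowr (f x) s) \<in> borel_measurable M"
  unfolding epowr_def by measurable

section \<open>Hoelder's inequality and a strict Schur test\<close>

lemma conjugate_exponent_gt_1:
  fixes p q :: real
  assumes "p > 1" "1 / p + 1 / q = 1" shows "q > 1"
proof -
  have "1 / q = 1 - 1 / p" using assms(2) by simp
  also have "\<dots> = (p - 1) / p" using assms(1) by (simp add: diff_divide_distrib)
  finally have "1 / q = (p - 1) / p" .
  then have "q = p / (p - 1)" by (metis inverse_divide inverse_eq_divide div_by_1 divide_divide_eq_right mult_1)
  then show ?thesis using assms(1) by simp
qed

lemma Young_ennreal:
  assumes p: "p > 1" and pq: "1 / p + 1 / q = (1::real)"
  shows "x * y \<le> ennreal (1 / p) * epowr x p + ennreal (1 / q) * epowr y q"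
proof -
  have q: "q > 1"
    by (rule conjugate_exponent_gt_1[OF p pq])
  show ?thesis
  proof (cases "x = top \<or> y = top")
    case True
    then show ?thesis
      using p q by (auto simp: ennreal_mult_top)
  next
    case False
    then obtain r s where "x = ennreal r" "y = ennreal s" "r \<ge> 0" "s \<ge> 0"
      by (cases x; cases y) auto
    moreover have "r * s \<le> r powr p / p + s powr q / q"
      using Youngs_inequality[OF p q pq] calculation by simp
    ultimately show ?thesis
      using p q by (simp add: epowr_ennreal ennreal_leI flip: ennreal_mult ennreal_plus)
  qed
qed

lemma nn_integral_Hoelder:
  assumes [measurable]: "f \<in> borel_measurable M" "g \<in> borel_measurable M"
    and p: "p > 1" and pq: "1 / p + 1 / q = (1::real)"
  shows "(\<integral>\<^sup>+x. f x * g x \<partial>M)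
           \<le> epowr (\<integral>\<^sup>+x. epowr (f x) p \<partial>M) (1 / p) * epowr (\<integral>\<^sup>+x. epowr (g x) q \<partial>M) (1 / q)"
proof -
  have q: "q > 1"
    by (rule conjugate_exponent_gt_1[OF p pq])
  define A where "A = (\<integral>\<^sup>+x. epowr (f x) p \<partial>M)"
  define B where "B = (\<integral>\<^sup>+x. epowr (g x) q \<partial>M)"
  consider "A = 0 \<or> B = 0" | "A \<noteq> 0" "B \<noteq> 0" "A = top \<or> B = top"
    | "A \<noteq> 0" "B \<noteq> 0" "A \<noteq> top" "B \<noteq> top" by blast
  then show ?thesis
  proof cases
    case 1
    then have "AE x in M. f x * g x = 0"
      unfolding A_def B_def
      by (elim disjE; subst (asm) nn_integral_0_iff_AE) auto
    then have "(\<integral>\<^sup>+x. f x * g x \<partial>M) = 0"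
      by (subst nn_integral_0_iff_AE) auto
    then show ?thesis by simp
  next
    case 2
    then have "epowr A (1 / p) * epowr B (1 / q) = top"
      by (auto simp: ennreal_mult_eq_top_iff)
    then show ?thesis by (simp add: A_def B_def)
  next
    case 3
    obtain a where a: "A = ennreal a" "a > 0"
      using 3 by (cases A) (auto simp: less_le)
    obtain b where b: "B = ennreal b" "b > 0"
      using 3 by (cases B) (auto simp: less_le)
    define u v where "u = a powr (1 / p)" and "v = b powr (1 / q)"
    have uv: "u > 0" "v > 0" using a b by (auto simp: u_def v_def)
    have up: "(1 / u) powr p = 1 / a" and vq: "(1 / v) powr q = 1 / b"
      using a b p q by (auto simp: u_def v_def powr_divide powr_powr)
    \<comment> \<open>Young's inequality for the normalised functions \<open>f / u\<close> and \<open>g / v\<close>.\<close>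
    have "ennreal (1 / (u * v)) * (\<integral>\<^sup>+x. f x * g x \<partial>M)
          = (\<integral>\<^sup>+x. (ennreal (1 / u) * f x) * (ennreal (1 / v) * g x) \<partial>M)"
      using uv
      by (subst nn_integral_cmult[symmetric])
         (auto intro!: nn_integral_cong simp: ennreal_mult mult_ac divide_inverse)
    also have "\<dots> \<le> (\<integral>\<^sup>+x. ennreal (1 / p) * epowr (ennreal (1 / u) * f x) p
                         + ennreal (1 / q) * epowr (ennreal (1 / v) * g x) q \<partial>M)"
      by (intro nn_integral_mono Young_ennreal p pq)
    also have "\<dots> = ennreal (1 / p) * (ennreal (1 / a) * A) + ennreal (1 / q) * (ennreal (1 / b) * B)"
      using p q uv
      by (simp add: nn_integral_add nn_integral_cmult epowr_mult epowr_ennreal up vq A_def B_def)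
    also have "\<dots> = 1"
      using a b p q pq by (simp flip: ennreal_mult ennreal_plus ennreal_1)
    finally have "ennreal (u * v) * (ennreal (1 / (u * v)) * (\<integral>\<^sup>+x. f x * g x \<partial>M)) \<le> ennreal (u * v) * 1"
      by (rule mult_left_mono) simp
    moreover have "ennreal (u * v) * ennreal (1 / (u * v)) = 1"
      using uv by (simp flip: ennreal_mult ennreal_1)
    ultimately have "(\<integral>\<^sup>+x. f x * g x \<partial>M) \<le> ennreal (u * v)"
      by (simp flip: mult.assoc)
    also have "\<dots> = epowr A (1 / p) * epowr B (1 / q)"
      using a b uv by (simp add: epowr_ennreal u_def v_def ennreal_mult)
    finally show ?thesis by (simp add: A_def B_def)
  qed
qed

text \<open>
  Hoelder's inequality for \<open>w f = w powr (1/q) \<cdot> (w powr (1/p) f)\<close>. It is Jensen's inequality for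
  \<open>t \<mapsto> t powr p\<close> and the measure with density \<open>w\<close>, without normalising that measure.
\<close>

lemma epowr_nn_integral_weighted_le:
  assumes [measurable]: "w \<in> borel_measurable M" "f \<in> borel_measurable M"
    and p: "p > 1"
  shows "epowr (\<integral>\<^sup>+x. w x * f x \<partial>M) p
           \<le> epowr (\<integral>\<^sup>+x. w x \<partial>M) (p - 1) * (\<integral>\<^sup>+x. w x * epowr (f x) p \<partial>M)"
proof -
  define q where "q = p / (p - 1)"
  have q: "q > 1" and pq: "1 / p + 1 / q = 1" and qp: "1 / q * p = p - 1"
    using p by (auto simp: q_def field_simps)
  have split: "w x = epowr (w x) (1 / q) * epowr (w x) (1 / p)" for x
    using p q pq epowr_add[of "1 / q" "1 / p" "w x"] by (simp add: add.commute)
  have "(\<integral>\<^sup>+x. w x * f x \<partial>M) = (\<integral>\<^sup>+x. (epowr (w x) (1 / p) * f x) * epowr (w x) (1 / q) \<partial>M)"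
    by (intro nn_integral_cong) (metis split mult.assoc mult.commute)
  also have "\<dots> \<le> epowr (\<integral>\<^sup>+x. epowr (epowr (w x) (1 / p) * f x) p \<partial>M) (1 / p)
                    * epowr (\<integral>\<^sup>+x. epowr (epowr (w x) (1 / q)) q \<partial>M) (1 / q)"
    by (intro nn_integral_Hoelder p pq) measurable
  also have "\<dots> = epowr (\<integral>\<^sup>+x. w x * epowr (f x) p \<partial>M) (1 / p) * epowr (\<integral>\<^sup>+x. w x \<partial>M) (1 / q)"
    using p q by (simp add: epowr_mult epowr_epowr)
  finally have "epowr (\<integral>\<^sup>+x. w x * f x \<partial>M) p
      \<le> epowr (epowr (\<integral>\<^sup>+x. w x * epowr (f x) p \<partial>M) (1 / p) * epowr (\<integral>\<^sup>+x. w x \<partial>M) (1 / q)) p"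
    using p by (intro epowr_mono) auto
  also have "\<dots> = (\<integral>\<^sup>+x. w x * epowr (f x) p \<partial>M) * epowr (\<integral>\<^sup>+x. w x \<partial>M) (p - 1)"
    using p q qp by (simp add: epowr_mult epowr_epowr)
  finally show ?thesis by (simp add: mult.commute)
qed

text \<open>
  With \<open>R y = \<integral> L x y dx\<close> and \<open>C x = \<integral> L x y dy\<close>, the weighted Hoelder inequality bounds the
  \<open>p\<close>-th power of the integral transform of \<open>F\<close> at \<open>y\<close> by
  \<open>R y powr (p - 1) \<cdot> \<integral> L x y \<cdot> F x powr p dx\<close>. Replacing \<open>R y\<close> by \<open>\<kappa>\<close>, exchanging the integrals
  and replacing \<open>C x\<close> by \<open>\<kappa>\<close> gives the constant \<open>\<kappa> powr p\<close>. One of the two replacements has to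
  lose something. Strictness of \<open>C x < \<kappa>\<close> is felt where \<open>F\<close> does not vanish. Strictness of
  \<open>R y < \<kappa>\<close> is felt where \<open>\<integral> L x y \<cdot> F x powr p dx\<close> is positive and finite; positivity of \<open>L\<close>
  makes that almost every \<open>y\<close>. Both forms are needed, because \<open>J\<^sub>1\<close> and \<open>J\<^sub>2\<close> apply the test to
  one kernel with the roles of its two variables interchanged.
\<close>

lemma Schur_test_strict:
  fixes L :: "'a \<Rightarrow> 'b \<Rightarrow> ennreal"
  assumes "sigma_finite_measure M" "sigma_finite_measure N"
    and L [measurable]: "(\<lambda>(x, y). L x y) \<in> borel_measurable (M \<Otimes>\<^sub>M N)"
    and F [measurable]: "F \<in> borel_measurable M"
    and p: "p > 1" and \<kappa>: "0 < \<kappa>" "\<kappa> < top"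
    and row: "\<And>y. y \<in> space N \<Longrightarrow> (\<integral>\<^sup>+x. L x y \<partial>M) \<le> \<kappa>"
    and col: "\<And>x. x \<in> space M \<Longrightarrow> (\<integral>\<^sup>+y. L x y \<partial>N) \<le> \<kappa>"
    and pos: "0 < (\<integral>\<^sup>+x. epowr (F x) p \<partial>M)" and fin: "(\<integral>\<^sup>+x. epowr (F x) p \<partial>M) < top"
    and strict: "(\<forall>x\<in>space M. (\<integral>\<^sup>+y. L x y \<partial>N) < \<kappa>) \<or>
                 ((\<forall>y\<in>space N. (\<integral>\<^sup>+x. L x y \<partial>M) < \<kappa>) \<and>
                  (\<forall>x\<in>space M. \<forall>y\<in>space N. 0 < L x y) \<and> \<not> (AE y in N. False))"
  shows "(\<integral>\<^sup>+y. epowr (\<integral>\<^sup>+x. L x y * F x \<partial>M) p \<partial>N)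
           < epowr \<kappa> p * (\<integral>\<^sup>+x. epowr (F x) p \<partial>M)"
proof -
  interpret M: sigma_finite_measure M by fact
  interpret N: sigma_finite_measure N by fact
  interpret pair_sigma_finite M N ..
  have [measurable]: "(\<lambda>(y, x). L x y) \<in> borel_measurable (N \<Otimes>\<^sub>M M)"
    using measurable_pair_swap[OF L] by (simp add: case_prod_unfold)
  define R T where "R y = (\<integral>\<^sup>+x. L x y \<partial>M)" and "T y = (\<integral>\<^sup>+x. L x y * epowr (F x) p \<partial>M)" for y
  define C X where "C x = (\<integral>\<^sup>+y. L x y \<partial>N)" and "X = (\<integral>\<^sup>+x. epowr (F x) p \<partial>M)" for x
  have [measurable]: "R \<in> borel_measurable N" "T \<in> borel_measurable N" "C \<in> borel_measurable M"
    unfolding R_def[abs_def] T_def[abs_def] C_def[abs_def] by measurable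
  have \<kappa>p: "epowr \<kappa> p = epowr \<kappa> (p - 1) * \<kappa>"
    using p epowr_add[of "p - 1" 1 \<kappa>] by simp
  have \<kappa>1: "0 < epowr \<kappa> (p - 1)" "epowr \<kappa> (p - 1) < top"
    using \<kappa> by (auto simp: zero_less_iff_neq_zero less_top[symmetric])
  have X: "0 < X" "X < top" using pos fin by (auto simp: X_def)
  have TX: "(\<integral>\<^sup>+y. T y \<partial>N) = (\<integral>\<^sup>+x. C x * epowr (F x) p \<partial>M)"
  proof -
    have "(\<integral>\<^sup>+y. T y \<partial>N) = (\<integral>\<^sup>+x. \<integral>\<^sup>+y. L x y * epowr (F x) p \<partial>N \<partial>M)"
      unfolding T_def by (rule Fubini') measurable
    also have "\<dots> = (\<integral>\<^sup>+x. C x * epowr (F x) p \<partial>M)"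
      unfolding C_def by (intro nn_integral_cong nn_integral_multc) measurable
    finally show ?thesis .
  qed
  have CX: "(\<integral>\<^sup>+x. C x * epowr (F x) p \<partial>M) \<le> (\<integral>\<^sup>+x. \<kappa> * epowr (F x) p \<partial>M)"
    unfolding C_def by (intro nn_integral_mono mult_right_mono col) auto
  have \<kappa>X: "(\<integral>\<^sup>+x. \<kappa> * epowr (F x) p \<partial>M) = \<kappa> * X"
    unfolding X_def by (rule nn_integral_cmult) measurable
  have \<kappa>X_fin: "\<kappa> * X < top" using X \<kappa> by (simp add: ennreal_mult_less_top)
  have T_fin: "(\<integral>\<^sup>+y. T y \<partial>N) < top"
    using TX CX \<kappa>X \<kappa>X_fin by (metis le_less_trans)
  have "AE x in M. epowr (F x) p \<noteq> \<infinity>"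
    using fin by (intro nn_integral_noteq_infinite) (auto simp: less_top)
  then have F_fin: "AE x in M. F x \<noteq> top" by simp
  have F_nz: "\<not> (AE x in M. F x = 0)"
  proof
    assume "AE x in M. F x = 0"
    then have "X = 0" unfolding X_def by (subst nn_integral_0_iff_AE) auto
    with X show False by simp
  qed
  have pointwise: "epowr (\<integral>\<^sup>+x. L x y * F x \<partial>M) p \<le> epowr (R y) (p - 1) * T y"
    if "y \<in> space N" for y
    unfolding R_def T_def using that p by (intro epowr_nn_integral_weighted_le) measurable
  have RK: "epowr (R y) (p - 1) \<le> epowr \<kappa> (p - 1)" if "y \<in> space N" for y
    using row[OF that] p by (intro epowr_mono) (auto simp: R_def)
  have I1: "(\<integral>\<^sup>+y. epowr (\<integral>\<^sup>+x. L x y * F x \<partial>M) p \<partial>N) \<le> (\<integral>\<^sup>+y. epowr (R y) (p - 1) * T y \<partial>N)"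
    by (intro nn_integral_mono pointwise)
  have I2: "(\<integral>\<^sup>+y. epowr (R y) (p - 1) * T y \<partial>N) \<le> (\<integral>\<^sup>+y. epowr \<kappa> (p - 1) * T y \<partial>N)"
    by (intro nn_integral_mono mult_right_mono RK) auto
  have \<kappa>T: "(\<integral>\<^sup>+y. epowr \<kappa> (p - 1) * T y \<partial>N) = epowr \<kappa> (p - 1) * (\<integral>\<^sup>+y. T y \<partial>N)"
    by (rule nn_integral_cmult) measurable
  from strict show ?thesis
  proof (elim disjE conjE)
    \<comment> \<open>The loss occurs after the integrals are exchanged.\<close>
    assume col': "\<forall>x\<in>space M. (\<integral>\<^sup>+y. L x y \<partial>N) < \<kappa>"
    have "(\<integral>\<^sup>+x. C x * epowr (F x) p \<partial>M) < (\<integral>\<^sup>+x. \<kappa> * epowr (F x) p \<partial>M)"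
    proof (rule nn_integral_less)
      show "(\<integral>\<^sup>+x. C x * epowr (F x) p \<partial>M) \<noteq> \<infinity>"
        using CX \<kappa>X \<kappa>X_fin by (auto simp: top_unique)
      show "AE x in M. C x * epowr (F x) p \<le> \<kappa> * epowr (F x) p"
        using col by (auto simp: C_def intro!: AE_I2 mult_right_mono)
      show "\<not> (AE x in M. \<kappa> * epowr (F x) p \<le> C x * epowr (F x) p)"
      proof
        assume "AE x in M. \<kappa> * epowr (F x) p \<le> C x * epowr (F x) p"
        then have "AE x in M. F x = 0"
          using F_fin AE_space
        proof eventually_elim
          case (elim x)
          show ?case
          proof (rule ccontr)
            assume "F x \<noteq> 0"
            then have "C x * epowr (F x) p < \<kappa> * epowr (F x) p"
              using elim col' by (intro ennreal_mult_strict_right_mono)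
                (auto simp: C_def zero_less_iff_neq_zero less_top[symmetric])
            with elim show False by simp
          qed
        qed
        with F_nz show False ..
      qed
    qed measurable
    then have "epowr \<kappa> (p - 1) * (\<integral>\<^sup>+y. T y \<partial>N) < epowr \<kappa> (p - 1) * (\<kappa> * X)"
      unfolding TX \<kappa>X using \<kappa>1 by (intro ennreal_mult_strict_left_mono)
    with I1 I2 \<kappa>T show ?thesis
      by (simp add: \<kappa>p X_def mult.assoc)
  next
    \<comment> \<open>The loss occurs before the integrals are exchanged.\<close>
    assume row': "\<forall>y\<in>space N. (\<integral>\<^sup>+x. L x y \<partial>M) < \<kappa>"
      and Lpos: "\<forall>x\<in>space M. \<forall>y\<in>space N. 0 < L x y" and N0: "\<not> (AE y in N. False)"
    have T_pos: "T y \<noteq> 0" if y: "y \<in> space N" for y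
    proof
      assume "T y = 0"
      then have "AE x in M. L x y * epowr (F x) p = 0"
        unfolding T_def using y by (subst (asm) nn_integral_0_iff_AE) auto
      then have "AE x in M. F x = 0"
        using AE_space by eventually_elim (use Lpos y in \<open>force\<close>)
      with F_nz show False ..
    qed
    have "(\<integral>\<^sup>+y. epowr (R y) (p - 1) * T y \<partial>N) < (\<integral>\<^sup>+y. epowr \<kappa> (p - 1) * T y \<partial>N)"
    proof (rule nn_integral_less)
      have "(\<integral>\<^sup>+y. epowr \<kappa> (p - 1) * T y \<partial>N) < top"
        unfolding \<kappa>T using \<kappa>1 T_fin by (simp add: ennreal_mult_less_top)
      with I2 show "(\<integral>\<^sup>+y. epowr (R y) (p - 1) * T y \<partial>N) \<noteq> \<infinity>"
        by (auto simp: top_unique)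
      show "AE y in N. epowr (R y) (p - 1) * T y \<le> epowr \<kappa> (p - 1) * T y"
        using RK by (auto intro!: AE_I2 mult_right_mono)
      show "\<not> (AE y in N. epowr \<kappa> (p - 1) * T y \<le> epowr (R y) (p - 1) * T y)"
      proof
        assume *: "AE y in N. epowr \<kappa> (p - 1) * T y \<le> epowr (R y) (p - 1) * T y"
        have "AE y in N. T y \<noteq> \<infinity>"
          using T_fin by (intro nn_integral_noteq_infinite) (auto simp: less_top)
        then have "AE y in N. False"
          using * AE_space
        proof eventually_elim
          case (elim y)
          have "epowr (R y) (p - 1) < epowr \<kappa> (p - 1)"
            using row' elim p by (intro epowr_strict_mono) (auto simp: R_def)
          then have "epowr (R y) (p - 1) * T y < epowr \<kappa> (p - 1) * T y"
            using elim T_pos[of y]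
            by (intro ennreal_mult_strict_right_mono) (auto simp: zero_less_iff_neq_zero less_top[symmetric])
          with elim show False by simp
        qed
        with N0 show False ..
      qed
    qed measurable
    also have "\<dots> \<le> epowr \<kappa> (p - 1) * (\<kappa> * X)"
      unfolding \<kappa>T TX using CX \<kappa>X by (intro mult_left_mono) auto
    finally show ?thesis
      using I1 by (simp add: \<kappa>p X_def mult.assoc)
  qed
qed

section \<open>Substitution and midpoint sums\<close>

text \<open>
  An inequality suffices throughout, and it spares the identification of the image \<open>g ` S\<close>: for the
  substitution \<open>t = U(x) powr \<delta> \<cdot> v\<close> used below, that image is a proper subinterval of the half-line
  when \<open>\<mu>\<close> has finite total integral. In the finite case the claim reduces to the change of
  variables formula for absolutely integrable functions.
\<close>

lemma nn_integral_substitution_le: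
  fixes g g' \<phi> :: "real \<Rightarrow> real"
  assumes S: "S \<in> sets lebesgue" and T: "T \<in> sets lebesgue"
    and der: "\<And>x. x \<in> S \<Longrightarrow> (g has_field_derivative g' x) (at x within S)"
    and inj: "inj_on g S" and sub: "g ` S \<subseteq> T"
    and \<phi>: "\<phi> \<in> borel_measurable (lebesgue_on T)" "\<And>t. t \<in> T \<Longrightarrow> 0 \<le> \<phi> t"
  shows "(\<integral>\<^sup>+x. ennreal (\<bar>g' x\<bar> * \<phi> (g x)) \<partial>lebesgue_on S) \<le> (\<integral>\<^sup>+t. ennreal (\<phi> t) \<partial>lebesgue_on T)"
proof (cases "(\<integral>\<^sup>+t. ennreal (\<phi> t) \<partial>lebesgue_on T) = \<infinity>")
  case False
  have int_T: "integrable (lebesgue_on T) \<phi>"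
    using \<phi> False T by (intro integrableI_nonneg) (auto simp: less_top space_restrict_space intro!: AE_I2)
  then have abs_T: "\<phi> absolutely_integrable_on T"
    using T by (simp add: integrable_restrict_space set_integrable_def)
  have gS: "g ` S \<in> sets lebesgue"
    using S der by (intro differentiable_image_in_sets_lebesgue)
      (auto simp: differentiable_on_def intro: field_differentiable_imp_differentiable
        intro!: real_differentiable_def[THEN iffD2])
  have abs_gS: "\<phi> absolutely_integrable_on g ` S"
    using abs_T gS sub by (rule set_integrable_subset)
  have *: "(\<lambda>x. \<bar>g' x\<bar> * \<phi> (g x)) absolutely_integrable_on S \<and>
         integral S (\<lambda>x. \<bar>g' x\<bar> * \<phi> (g x)) = integral (g ` S) \<phi>"
    using has_absolute_integral_change_of_variables_1'[OF S der inj] abs_gS by blast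
  then have int_S: "integrable (lebesgue_on S) (\<lambda>x. \<bar>g' x\<bar> * \<phi> (g x))"
    using S by (simp add: integrable_restrict_space set_integrable_def)
  have "(\<integral>\<^sup>+x. ennreal (\<bar>g' x\<bar> * \<phi> (g x)) \<partial>lebesgue_on S) = ennreal (integral (g ` S) \<phi>)"
    using \<phi>(2) subsetD[OF sub, OF imageI] *
    by (subst nn_integral_eq_integral[OF int_S])
       (auto simp: space_restrict_space lebesgue_integral_eq_integral[OF int_S S] intro!: AE_I2 mult_nonneg_nonneg)
  also have "\<dots> \<le> ennreal (integral T \<phi>)"
    using sub \<phi>(2) abs_T abs_gS
    by (intro ennreal_leI integral_subset_le) (auto simp: set_lebesgue_integral_eq_integral(1))
  also have "\<dots> = (\<integral>\<^sup>+t. ennreal (\<phi> t) \<partial>lebesgue_on T)"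
    using \<phi>(2)
    by (subst nn_integral_eq_integral[OF int_T])
       (auto simp: space_restrict_space lebesgue_integral_eq_integral[OF int_T T] intro!: AE_I2)
  finally show ?thesis .
qed auto

text \<open>
  Only points \<open>m - s > 0\<close> are involved, since the functions of interest blow up at \<open>0\<close>.
\<close>

definition strict_midpoint_convex :: "(real \<Rightarrow> real) \<Rightarrow> bool" where
  "strict_midpoint_convex \<phi> \<longleftrightarrow> (\<forall>m s. 0 < s \<longrightarrow> s < m \<longrightarrow> 2 * \<phi> m < \<phi> (m - s) + \<phi> (m + s))"

lemma AE_lebesgue_on_False:
  assumes "S \<in> sets lebesgue" "emeasure lebesgue S \<noteq> 0"
  shows "\<not> (AE x in lebesgue_on S. False)"
proof
  assume "AE x in lebesgue_on S. False"
  then have "emeasure (lebesgue_on S) (space (lebesgue_on S)) = 0"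
    by (subst (asm) AE_iff_null) (auto simp: null_sets_def)
  with assms show False by (simp add: emeasure_restrict_space space_restrict_space)
qed

text \<open>
  The left half of the Hermite--Hadamard inequality. Folding the interval at its midpoint \<open>m\<close> turns
  the integral into \<open>\<integral> (\<phi> (m - s) + \<phi> (m + s)) ds\<close> over half the length, whose integrand exceeds
  \<open>2 \<phi> m\<close> everywhere. This covers \<open>a = 0\<close>, where \<open>\<phi>\<close> may be unbounded.
\<close>

lemma midpoint_less_nn_integral:
  fixes \<phi> :: "real \<Rightarrow> real"
  assumes convex: "strict_midpoint_convex \<phi>" and cont: "continuous_on {0<..} \<phi>"
    and nonneg: "\<And>t. t > 0 \<Longrightarrow> 0 \<le> \<phi> t" and ab: "0 \<le> a" "a < b"
  shows "ennreal ((b - a) * \<phi> ((a + b) / 2)) < (\<integral>\<^sup>+t. ennreal (\<phi> t) \<partial>lebesgue_on {a<..b})"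
proof -
  define m r where "m = (a + b) / 2" and "r = (b - a) / 2"
  have mr: "0 < r" "r \<le> m" "0 < m" "a = m - r" "b = m + r" "b - a = 2 * r"
    using ab by (auto simp: m_def r_def field_simps)
  have leb [simp]: "S \<in> sets lebesgue" if "S \<in> sets borel" for S :: "real set"
    using that by simp
  have meas: "\<phi> \<in> borel_measurable (lebesgue_on S)" if "S \<subseteq> {0<..}" "S \<in> sets borel" for S
    using that by (intro continuous_imp_measurable_on_sets_lebesgue continuous_on_subset[OF cont]) auto
  have meas_m: "(\<lambda>s. \<phi> (m - s)) \<in> borel_measurable (lebesgue_on {0<..<r})"
    "(\<lambda>s. \<phi> (m + s)) \<in> borel_measurable (lebesgue_on {0<..<r})"
    using mr by (auto intro!: continuous_imp_measurable_on_sets_lebesgue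
        continuous_on_compose2[OF cont] continuous_intros)
  have const: "(\<integral>\<^sup>+s. ennreal (2 * \<phi> m) \<partial>lebesgue_on {0<..<r}) = ennreal ((b - a) * \<phi> m)"
    using mr nonneg[of m]
    by (simp add: nn_integral_const emeasure_restrict_space space_restrict_space mult_ac flip: ennreal_mult)
  have "(\<integral>\<^sup>+s. ennreal (2 * \<phi> m) \<partial>lebesgue_on {0<..<r})
      < (\<integral>\<^sup>+s. ennreal (\<phi> (m - s) + \<phi> (m + s)) \<partial>lebesgue_on {0<..<r})"
  proof (rule nn_integral_less)
    have lt: "2 * \<phi> m < \<phi> (m - s) + \<phi> (m + s)" if "s \<in> {0<..<r}" for s
      using convex that mr by (auto simp: strict_midpoint_convex_def)
    show "(\<integral>\<^sup>+s. ennreal (2 * \<phi> m) \<partial>lebesgue_on {0<..<r}) \<noteq> \<infinity>"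
      using const by simp
    show "AE s in lebesgue_on {0<..<r}. ennreal (2 * \<phi> m) \<le> ennreal (\<phi> (m - s) + \<phi> (m + s))"
      using lt by (intro AE_I2 ennreal_leI) (force simp: space_restrict_space)
    show "\<not> (AE s in lebesgue_on {0<..<r}. ennreal (\<phi> (m - s) + \<phi> (m + s)) \<le> ennreal (2 * \<phi> m))"
    proof
      assume "AE s in lebesgue_on {0<..<r}. ennreal (\<phi> (m - s) + \<phi> (m + s)) \<le> ennreal (2 * \<phi> m)"
      then have "AE s in lebesgue_on {0<..<r}. False"
        using AE_space
      proof eventually_elim
        case (elim s)
        then have "\<phi> (m - s) + \<phi> (m + s) \<le> 2 * \<phi> m"
          using nonneg[of m] mr by (subst (asm) ennreal_le_iff) auto
        with lt[of s] elim show False by (auto simp: space_restrict_space)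
      qed
      moreover have "\<not> (AE s in lebesgue_on {0<..<r}. False)"
        using mr by (intro AE_lebesgue_on_False) auto
      ultimately show False by simp
    qed
    show "(\<lambda>s. ennreal (\<phi> (m - s) + \<phi> (m + s))) \<in> borel_measurable (lebesgue_on {0<..<r})"
      using meas_m by measurable
  qed simp
  also have "\<dots> = (\<integral>\<^sup>+s. ennreal (\<phi> (m - s)) + ennreal (\<phi> (m + s)) \<partial>lebesgue_on {0<..<r})"
    using mr by (intro nn_integral_cong ennreal_plus nonneg) (auto simp: space_restrict_space)
  also have "\<dots> = (\<integral>\<^sup>+s. ennreal (\<phi> (m - s)) \<partial>lebesgue_on {0<..<r})
      + (\<integral>\<^sup>+s. ennreal (\<phi> (m + s)) \<partial>lebesgue_on {0<..<r})"
    using meas_m by (intro nn_integral_add measurable_compose[OF _ measurable_ennreal])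
  also have "\<dots> \<le> (\<integral>\<^sup>+t. ennreal (\<phi> t) \<partial>lebesgue_on {a<..m}) + (\<integral>\<^sup>+t. ennreal (\<phi> t) \<partial>lebesgue_on {m<..b})"
  proof (rule add_mono)
    have "(\<integral>\<^sup>+s. ennreal (\<bar>-1\<bar> * \<phi> (m - s)) \<partial>lebesgue_on {0<..<r}) \<le> (\<integral>\<^sup>+t. ennreal (\<phi> t) \<partial>lebesgue_on {a<..m})"
      using mr ab
      by (intro nn_integral_substitution_le meas)
         (auto intro!: derivative_eq_intros nonneg simp: inj_on_def)
    then show "(\<integral>\<^sup>+s. ennreal (\<phi> (m - s)) \<partial>lebesgue_on {0<..<r}) \<le> (\<integral>\<^sup>+t. ennreal (\<phi> t) \<partial>lebesgue_on {a<..m})"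
      by simp
    have "(\<integral>\<^sup>+s. ennreal (\<bar>1\<bar> * \<phi> (m + s)) \<partial>lebesgue_on {0<..<r}) \<le> (\<integral>\<^sup>+t. ennreal (\<phi> t) \<partial>lebesgue_on {m<..b})"
      using mr ab
      by (intro nn_integral_substitution_le meas)
         (auto intro!: derivative_eq_intros nonneg simp: inj_on_def)
    then show "(\<integral>\<^sup>+s. ennreal (\<phi> (m + s)) \<partial>lebesgue_on {0<..<r}) \<le> (\<integral>\<^sup>+t. ennreal (\<phi> t) \<partial>lebesgue_on {m<..b})"
      by simp
  qed
  also have "\<dots> = (\<integral>\<^sup>+t. ennreal (\<phi> t) \<partial>lebesgue_on {a<..b})"
  proof -
    have "{a<..b} = {a<..m} \<union> {m<..b}" using mr by auto
    moreover have "(\<lambda>t. ennreal (\<phi> t) * indicator {a<..m} t) \<in> borel_measurable lebesgue"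
      "(\<lambda>t. ennreal (\<phi> t) * indicator {m<..b} t) \<in> borel_measurable lebesgue"
      using ab mr
      by (auto simp: borel_measurable_restrict_space_iff_ennreal[symmetric]
            intro!: measurable_compose[OF meas measurable_ennreal])
    moreover have "indicator ({a<..m} \<union> {m<..b}) t
        = indicator {a<..m} t + (indicator {m<..b} t :: ennreal)" for t
      by (auto simp: indicator_def)
    ultimately show ?thesis
      by (simp add: nn_integral_restrict_space nn_integral_add[symmetric] distrib_left)
  qed
  finally show ?thesis using const by (simp add: m_def)
qed

lemma suminf_strict_mono_ennreal:
  fixes a b :: "nat \<Rightarrow> ennreal"
  assumes "\<And>n. a n < b n" and "(\<Sum>n. b n) < \<infinity>"
  shows "(\<Sum>n. a n) < (\<Sum>n. b n)"
proof -
  have "(\<Sum>n. a n) \<le> (\<Sum>n. b n)" using assms by (intro suminf_le) (auto intro: less_imp_le)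
  then show ?thesis
    using assms nn_integral_less[of a "count_space UNIV" b]
    by (auto simp: nn_integral_count_space_nat AE_count_space not_le less_imp_le top_unique)
qed

text \<open>
  Each summand is compared with the integral over its interval \<open>{v n<..v (Suc n)}\<close>: sampling at or
  to the right of the midpoint only lowers the value of a decreasing function. These intervals are
  disjoint, so their integrals add up to at most the integral over the half-line.
\<close>

lemma suminf_midpoints_less_nn_integral:
  fixes \<phi> :: "real \<Rightarrow> real" and v w :: "nat \<Rightarrow> real"
  assumes convex: "strict_midpoint_convex \<phi>" and cont: "continuous_on {0<..} \<phi>"
    and anti: "antimono_on {0<..} \<phi>" and nonneg: "\<And>t. t > 0 \<Longrightarrow> 0 \<le> \<phi> t"
    and v: "0 \<le> v 0" "\<And>n. v n < v (Suc n)" and w: "\<And>n. (v n + v (Suc n)) / 2 \<le> w n"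
    and fin: "(\<integral>\<^sup>+t. ennreal (\<phi> t) \<partial>lebesgue_on {0<..}) < \<infinity>"
  shows "(\<Sum>n. ennreal ((v (Suc n) - v n) * \<phi> (w n))) < (\<integral>\<^sup>+t. ennreal (\<phi> t) \<partial>lebesgue_on {0<..})"
proof -
  have inc: "strict_mono v" using v(2) by (simp add: strict_mono_Suc_iff)
  have v0: "0 \<le> v n" for n
    using v(1) strict_mono_less_eq[OF inc, of 0 n] by simp
  define I where "I n = {v n<..v (Suc n)}" for n
  have "I i \<inter> I j = {}" if "i < j" for i j
    using strict_mono_less_eq[OF inc, of "Suc i" j] that by (auto simp: I_def)
  then have disj: "disjoint_family I"
    unfolding disjoint_family_on_def by (metis Int_commute nat_neq_iff)
  have \<phi>m: "(\<lambda>t. ennreal (\<phi> t)) \<in> borel_measurable (lebesgue_on {0<..})"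
    by (intro measurable_compose[OF _ measurable_ennreal] continuous_imp_measurable_on_sets_lebesgue cont) auto
  define D where "D = density (lebesgue_on {0<..}) (\<lambda>t. ennreal (\<phi> t))"
  have I_sub: "I n \<subseteq> {0<..}" for n using v0[of n] by (auto simp: I_def)
  have I_sets: "I n \<in> sets (lebesgue_on {0<..})" for n
    using I_sub[of n] by (auto simp: sets_restrict_space I_def image_iff intro!: bexI[of _ "I n"])
  have D_I: "emeasure D (I n) = (\<integral>\<^sup>+t. ennreal (\<phi> t) \<partial>lebesgue_on (I n))" for n
  proof -
    have "indicator {0<..} t * indicator (I n) t = (indicator (I n) t :: ennreal)" for t
      using I_sub[of n] by (auto simp: indicator_def)
    then show ?thesis
      unfolding D_def using I_sets[of n] \<phi>m
      by (subst emeasure_density)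
         (auto simp: nn_integral_restrict_space I_def mult_ac mult.left_commute
           intro!: nn_integral_cong split: split_indicator)
  qed
  have "(\<Sum>n. emeasure D (I n)) = emeasure D (\<Union>n. I n)"
    using I_sets disj by (intro suminf_emeasure) (auto simp: D_def)
  also have "\<dots> \<le> emeasure D (space D)" by (rule emeasure_space)
  also have "\<dots> = (\<integral>\<^sup>+t. ennreal (\<phi> t) \<partial>lebesgue_on {0<..})"
    unfolding D_def using \<phi>m by (subst emeasure_density) (auto intro!: nn_integral_cong)
  finally have total: "(\<Sum>n. emeasure D (I n)) \<le> (\<integral>\<^sup>+t. ennreal (\<phi> t) \<partial>lebesgue_on {0<..})" .
  have "ennreal ((v (Suc n) - v n) * \<phi> (w n)) < emeasure D (I n)" for n
  proof -
    have "\<phi> (w n) \<le> \<phi> ((v n + v (Suc n)) / 2)"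
      using w[of n] v0[of n] v(2)[of n] by (intro monotone_onD[OF anti]) auto
    then have "ennreal ((v (Suc n) - v n) * \<phi> (w n))
        \<le> ennreal ((v (Suc n) - v n) * \<phi> ((v n + v (Suc n)) / 2))"
      using v(2)[of n] by (intro ennreal_leI mult_left_mono) auto
    also have "\<dots> < emeasure D (I n)"
      by (subst D_I, unfold I_def) (intro midpoint_less_nn_integral convex cont nonneg v0 v(2))
    finally show ?thesis .
  qed
  then have "(\<Sum>n. ennreal ((v (Suc n) - v n) * \<phi> (w n))) < (\<Sum>n. emeasure D (I n))"
    using total fin by (intro suminf_strict_mono_ennreal) auto
  with total show ?thesis by simp
qed

section \<open>The profile of the kernel\<close>

text \<open>
  The kernel \<open>H\<close> at \<open>(x, n)\<close> is the profile at \<open>U(x) powr \<delta> \<cdot> Vt n\<close>.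
\<close>

definition profile :: "real \<Rightarrow> real \<Rightarrow> real \<Rightarrow> real \<Rightarrow> real" where
  "profile \<alpha> \<rho> \<gamma> t = csch (\<rho> * t powr \<gamma>) / exp (\<alpha> * t powr \<gamma>)"

text \<open>
  The integrand of \<open>k \<sigma>\<close>.
\<close>

definition weighted_profile :: "real \<Rightarrow> real \<Rightarrow> real \<Rightarrow> real \<Rightarrow> real \<Rightarrow> real" where
  "weighted_profile \<alpha> \<rho> \<gamma> \<sigma> t = profile \<alpha> \<rho> \<gamma> t * t powr (\<sigma> - 1)"

lemma csch_pos: "u > 0 \<Longrightarrow> 0 < csch u"
  by (simp add: csch_def)

lemma csch_antimono: "0 < u \<Longrightarrow> u \<le> v \<Longrightarrow> csch v \<le> csch u"
  unfolding csch_def by (intro divide_left_mono mult_pos_pos diff_mono) auto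

text \<open>
  The factor \<open>1 / u\<close> carries the singularity at \<open>0\<close> and the exponential the decay at infinity, so
  that the integral of the profile is dominated by two Gamma integrals. With \<open>E = exp u\<close> the claim
  amounts to \<open>1 + 2 u \<le> E\<^sup>2\<close>.
\<close>

lemma csch_le:
  assumes u: "u > 0" shows "csch u \<le> (1 / u + 2) / exp u"
proof -
  define E where "E = exp u"
  have "exp (2 * u) = E * E" unfolding E_def mult_2 by (rule exp_add)
  then have EE: "1 + 2 * u \<le> E * E" using exp_ge_add_one_self[of "2 * u"] by simp
  have "E > 0" by (simp add: E_def)
  have pos: "E * E - 1 > 0" using EE u by linarith
  have "csch u = 2 / (E - 1 / E)" by (simp add: csch_def E_def exp_minus inverse_eq_divide)
  also have "E - 1 / E = (E * E - 1) / E" using \<open>E > 0\<close> by (simp add: field_simps)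
  finally have "csch u = 2 * E / (E * E - 1)" by simp
  also have "\<dots> \<le> (1 + 2 * u) / (u * E)"
  proof -
    have "2 * E * (u * E) \<le> (1 + 2 * u) * (E * E - 1)"
      using EE by (simp add: algebra_simps)
    then have "2 * E * (u * E) / (E * E - 1) \<le> 1 + 2 * u"
      using pos by (intro mult_imp_div_pos_le)
    then show ?thesis
      using u \<open>E > 0\<close> by (intro mult_imp_le_div_pos) auto
  qed
  also have "\<dots> = (1 / u + 2) / E"
    using u by (simp add: add_divide_distrib)
  finally show ?thesis by (simp add: E_def)
qed

text \<open>
  Taking reciprocals, this follows from \<open>sinh\<^sup>2 m = sinh (m + d) sinh (m - d) + sinh\<^sup>2 d\<close>, with
  \<open>m\<close> the midpoint and \<open>d\<close> half the distance of \<open>a\<close> and \<open>b\<close>.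
\<close>

lemma csch_midpoint_log_convex:
  assumes "0 < a" "0 < b" "a \<noteq> b"
  shows "(csch ((a + b) / 2))\<^sup>2 < csch a * csch b"
proof -
  define d where "d = (a - b) / 2"
  define m where "m = (a + b) / 2"
  have ab: "a = m + d" "b = m - d" "m > 0" "d \<noteq> 0" using assms by (auto simp: d_def m_def field_simps)
  have "(exp d - exp (- d))\<^sup>2 > 0" using ab by auto
  moreover have "(exp m - exp (- m))\<^sup>2 = (exp a - exp (- a)) * (exp b - exp (- b)) + (exp d - exp (- d))\<^sup>2"
  proof -
    define x y where "x = exp m" and "y = exp d"
    have "x > 0" "y > 0" by (auto simp: x_def y_def)
    then have "(x - 1 / x)\<^sup>2 = (x * y - 1 / (x * y)) * (x / y - y / x) + (y - 1 / y)\<^sup>2"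
      by (simp add: power2_eq_square field_simps)
    moreover have "exp a = x * y" "exp b = x / y" "exp (- a) = 1 / (x * y)" "exp (- b) = y / x"
      "exp (- m) = 1 / x" "exp (- d) = 1 / y"
      by (simp_all add: ab x_def y_def exp_add exp_diff exp_minus inverse_eq_divide)
    ultimately show ?thesis
      by (simp only: x_def[symmetric] y_def[symmetric])
  qed
  ultimately have "(exp a - exp (- a)) * (exp b - exp (- b)) < (exp m - exp (- m))\<^sup>2" by simp
  moreover have "(exp a - exp (- a)) * (exp b - exp (- b)) > 0" using assms by simp
  ultimately have "4 / (exp m - exp (- m))\<^sup>2 < 4 / ((exp a - exp (- a)) * (exp b - exp (- b)))"
    by (intro divide_strict_left_mono mult_pos_pos[of "(exp m - exp (- m))\<^sup>2"]) (auto intro: less_trans)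
  then show ?thesis by (simp add: csch_def power_divide m_def[symmetric])
qed

lemma powr_left_inj:
  fixes x y s :: real
  assumes "x powr s = y powr s" "s \<noteq> 0" "x > 0" "y > 0" shows "x = y"
proof -
  have "(z powr s) powr (1 / s) = z" if "z > 0" for z
    using assms(2) that by (simp add: powr_powr)
  then show ?thesis using assms by metis
qed

text \<open>
  Concavity: both values lie below the tangent of \<open>t powr \<gamma>\<close> at \<open>m\<close>.
\<close>

lemma powr_add_le_midpoint:
  fixes m s \<gamma> :: real
  assumes "0 < s" "s < m" "0 < \<gamma>" "\<gamma> < 1"
  shows "(m - s) powr \<gamma> + (m + s) powr \<gamma> \<le> 2 * m powr \<gamma>"
proof -
  have tangent: "(m + r) powr \<gamma> \<le> m powr \<gamma> * (1 + \<gamma> * (r / m))" if "m + r > 0" for r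
  proof -
    have "((m + r) / m) powr \<gamma> * 1 powr (1 - \<gamma>) \<le> \<gamma> * ((m + r) / m) + (1 - \<gamma>) * 1"
      using assms that by (intro Youngs_inequality_0) auto
    then have "((m + r) / m) powr \<gamma> \<le> 1 + \<gamma> * (r / m)"
      using assms by (simp add: field_simps)
    then show ?thesis
      using assms that by (simp add: powr_divide field_simps)
  qed
  show ?thesis
    using tangent[of s] tangent[of "- s"] assms by (simp add: algebra_simps)
qed

context
  fixes \<alpha> \<rho> \<gamma> \<sigma> :: real
  assumes \<alpha>: "0 \<le> \<alpha>" and \<rho>: "0 < \<rho>" and \<gamma>: "0 < \<gamma>" and \<gamma>\<sigma>: "\<gamma> < \<sigma>" and \<sigma>: "\<sigma> \<le> 1"
begin

lemma profile_pos: "t > 0 \<Longrightarrow> 0 < profile \<alpha> \<rho> \<gamma> t"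
  unfolding profile_def using \<rho> by (auto intro!: divide_pos_pos csch_pos)

lemma weighted_profile_pos: "t > 0 \<Longrightarrow> 0 < weighted_profile \<alpha> \<rho> \<gamma> \<sigma> t"
  unfolding weighted_profile_def by (simp add: profile_pos)

lemma continuous_on_profile: "continuous_on {0<..} (profile \<alpha> \<rho> \<gamma>)"
proof -
  have "exp (\<rho> * t powr \<gamma>) - exp (- (\<rho> * t powr \<gamma>)) \<noteq> 0" if "t > 0" for t
    using \<rho> that by simp
  then show ?thesis
    unfolding profile_def csch_def by (auto intro!: continuous_intros)
qed

lemma continuous_on_weighted_profile: "continuous_on {0<..} (weighted_profile \<alpha> \<rho> \<gamma> \<sigma>)"
  unfolding weighted_profile_def by (auto intro!: continuous_intros continuous_on_profile)

lemma antimono_on_weighted_profile: "antimono_on {0<..} (weighted_profile \<alpha> \<rho> \<gamma> \<sigma>)"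
proof (rule monotone_onI)
  fix s t :: real assume st: "s \<in> {0<..}" "t \<in> {0<..}" "s \<le> t"
  then have "s powr \<gamma> \<le> t powr \<gamma>" using \<gamma> by (intro powr_mono2) auto
  moreover have "t powr (\<sigma> - 1) \<le> s powr (\<sigma> - 1)" using st \<sigma> by (intro powr_mono2') auto
  ultimately show "weighted_profile \<alpha> \<rho> \<gamma> \<sigma> t \<le> weighted_profile \<alpha> \<rho> \<gamma> \<sigma> s"
    unfolding weighted_profile_def profile_def using st \<alpha> \<rho>
    by (intro mult_mono frac_le csch_antimono) (auto intro!: less_imp_le[OF csch_pos] divide_nonneg_pos mult_left_mono)
qed

text \<open>
  Log-convexity is inherited by products, so each factor is treated separately: for \<open>csch\<close> and \<open>exp\<close> by
  their own (log-)convexity and monotonicity combined with concavity of \<open>t powr \<gamma>\<close> (this needs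
  \<open>\<gamma> < 1\<close>), for the power weight by \<open>(m - s) (m + s) \<le> m\<^sup>2\<close> and \<open>\<sigma> \<le> 1\<close>. The first factor
  supplies the strictness, also when \<open>\<sigma> = 1\<close> and the weight is constant.
\<close>

lemma weighted_profile_midpoint_log_convex:
  assumes s: "0 < s" "s < m"
  shows "(weighted_profile \<alpha> \<rho> \<gamma> \<sigma> m)\<^sup>2
           < weighted_profile \<alpha> \<rho> \<gamma> \<sigma> (m - s) * weighted_profile \<alpha> \<rho> \<gamma> \<sigma> (m + s)"
proof -
  define x y z where "x = (m - s) powr \<gamma>" and "y = (m + s) powr \<gamma>" and "z = m powr \<gamma>"
  have xyz: "x + y \<le> 2 * z" "0 < x" "0 < y" "0 < z"
    using powr_add_le_midpoint[OF s \<gamma>] \<gamma>\<sigma> \<sigma> s by (auto simp: x_def y_def z_def)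
  have "x < y" unfolding x_def y_def using s \<gamma> by (intro powr_less_mono2) auto
  have 1: "(csch (\<rho> * z))\<^sup>2 < csch (\<rho> * x) * csch (\<rho> * y)"
  proof -
    have "csch (\<rho> * z) \<le> csch ((\<rho> * x + \<rho> * y) / 2)"
      using xyz \<rho> by (intro csch_antimono) (auto simp: distrib_left[symmetric])
    then have "(csch (\<rho> * z))\<^sup>2 \<le> (csch ((\<rho> * x + \<rho> * y) / 2))\<^sup>2"
      using xyz \<rho> by (intro power_mono) (auto intro!: less_imp_le[OF csch_pos])
    also have "\<dots> < csch (\<rho> * x) * csch (\<rho> * y)"
      using xyz \<rho> \<open>x < y\<close> by (intro csch_midpoint_log_convex) auto
    finally show ?thesis .
  qed
  have 2: "exp (\<alpha> * x) * exp (\<alpha> * y) \<le> (exp (\<alpha> * z))\<^sup>2"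
    using mult_left_mono[OF xyz(1) \<alpha>] by (simp add: power2_eq_square algebra_simps flip: exp_add)
  have 3: "(m powr (\<sigma> - 1))\<^sup>2 \<le> (m - s) powr (\<sigma> - 1) * (m + s) powr (\<sigma> - 1)"
  proof -
    have "(m * m) powr (\<sigma> - 1) \<le> ((m - s) * (m + s)) powr (\<sigma> - 1)"
      using s \<sigma> mult_strict_mono[of s m s m]
      by (intro powr_mono2') (auto simp: algebra_simps)
    then show ?thesis using s by (simp add: powr_mult power2_eq_square)
  qed
  have "(weighted_profile \<alpha> \<rho> \<gamma> \<sigma> m)\<^sup>2 = (csch (\<rho> * z))\<^sup>2 / (exp (\<alpha> * z))\<^sup>2 * (m powr (\<sigma> - 1))\<^sup>2"
    by (simp add: weighted_profile_def profile_def z_def power_mult_distrib power_divide)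
  also have "\<dots> < (csch (\<rho> * x) * csch (\<rho> * y)) / (exp (\<alpha> * z))\<^sup>2 * (m powr (\<sigma> - 1))\<^sup>2"
    using 1 s by (intro mult_strict_right_mono divide_strict_right_mono) auto
  also have "\<dots> \<le> (csch (\<rho> * x) * csch (\<rho> * y)) / (exp (\<alpha> * x) * exp (\<alpha> * y))
                      * ((m - s) powr (\<sigma> - 1) * (m + s) powr (\<sigma> - 1))"
    using 1 2 3 xyz \<rho> csch_pos[of "\<rho> * x"] csch_pos[of "\<rho> * y"]
    by (intro mult_mono divide_left_mono) auto
  also have "\<dots> = weighted_profile \<alpha> \<rho> \<gamma> \<sigma> (m - s) * weighted_profile \<alpha> \<rho> \<gamma> \<sigma> (m + s)"
    by (simp add: weighted_profile_def profile_def x_def y_def)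
  finally show ?thesis .
qed

text \<open>
  Log-convexity together with the inequality between the arithmetic and the geometric mean.
\<close>

lemma strict_midpoint_convex_weighted_profile: "strict_midpoint_convex (weighted_profile \<alpha> \<rho> \<gamma> \<sigma>)"
  unfolding strict_midpoint_convex_def
proof (intro allI impI)
  fix m s :: real assume s: "0 < s" "s < m"
  define A B where "A = weighted_profile \<alpha> \<rho> \<gamma> \<sigma> (m - s)" and "B = weighted_profile \<alpha> \<rho> \<gamma> \<sigma> (m + s)"
  have "(2 * weighted_profile \<alpha> \<rho> \<gamma> \<sigma> m)\<^sup>2 < 4 * (A * B)"
    using weighted_profile_midpoint_log_convex[OF s] by (simp add: A_def B_def power_mult_distrib)
  also have "\<dots> \<le> (A + B)\<^sup>2"
    using zero_le_power2[of "A - B"] by (simp add: power2_eq_square algebra_simps)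
  finally have "2 * weighted_profile \<alpha> \<rho> \<gamma> \<sigma> m < A + B"
    using s by (elim power2_less_imp_less) (auto simp: A_def B_def intro!: add_nonneg_nonneg less_imp_le[OF weighted_profile_pos])
  then show "2 * weighted_profile \<alpha> \<rho> \<gamma> \<sigma> m
      < weighted_profile \<alpha> \<rho> \<gamma> \<sigma> (m - s) + weighted_profile \<alpha> \<rho> \<gamma> \<sigma> (m + s)"
    by (simp add: A_def B_def)
qed

text \<open>
  The substitution \<open>u = \<rho> t powr \<gamma>\<close> leads to the Gamma integral at \<open>s / \<gamma>\<close>.
\<close>

lemma nn_integral_powr_exp_powr_finite:
  assumes s: "s > 0"
  shows "(\<integral>\<^sup>+t. ennreal (t powr (s - 1) / exp (\<rho> * t powr \<gamma>)) \<partial>lebesgue_on {0<..}) < \<infinity>"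
proof -
  define z where "z = s / \<gamma>"
  have z: "z > 0" "\<gamma> * z = s" using s \<gamma> by (auto simp: z_def)
  define c where "c = \<gamma> * \<rho> powr z"
  have c: "c > 0" using \<gamma> \<rho> by (simp add: c_def)
  have eq: "t powr (s - 1) / exp (\<rho> * t powr \<gamma>)
      = 1 / c * (\<bar>\<rho> * (\<gamma> * t powr (\<gamma> - 1))\<bar> * ((\<rho> * t powr \<gamma>) powr (z - 1) / exp (\<rho> * t powr \<gamma>)))"
    if "t > 0" for t
  proof -
    have "t powr (\<gamma> - 1) * t powr (\<gamma> * (z - 1)) = t powr (s - 1)"
      using z by (simp add: algebra_simps flip: powr_add)
    moreover have "\<rho> * \<rho> powr (z - 1) = \<rho> powr z"
      using \<rho> powr_add[of \<rho> 1 "z - 1"] by simp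
    ultimately show ?thesis
      using that \<rho> \<gamma> c by (simp add: powr_mult powr_powr abs_mult c_def field_simps)
  qed
  have meas: "(\<lambda>t. t powr (z - 1) / exp t) \<in> borel_measurable (lebesgue_on {0<..})"
    by (intro continuous_imp_measurable_on_sets_lebesgue) (auto intro!: continuous_intros)
  have fin: "(\<integral>\<^sup>+t. ennreal (t powr (z - 1) / exp t) \<partial>lebesgue_on {0<..}) < \<infinity>"
  proof -
    have "(\<integral>\<^sup>+t. ennreal (t powr (z - 1) / exp t) \<partial>lebesgue_on {0<..})
        \<le> (\<integral>\<^sup>+t. ennreal (indicator {0..} t * t powr (z - 1) / exp t) \<partial>lebesgue)"
      by (subst nn_integral_restrict_space) (auto intro!: nn_integral_mono split: split_indicator)
    also have "\<dots> = ennreal (Gamma z)"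
      using Gamma_conv_nn_integral_real[OF z(1)] by (simp add: nn_integral_completion)
    finally show ?thesis by (simp add: le_less_trans)
  qed
  have "(\<integral>\<^sup>+t. ennreal (t powr (s - 1) / exp (\<rho> * t powr \<gamma>)) \<partial>lebesgue_on {0<..})
      = (\<integral>\<^sup>+t. ennreal (1 / c) * ennreal (\<bar>\<rho> * (\<gamma> * t powr (\<gamma> - 1))\<bar>
            * ((\<rho> * t powr \<gamma>) powr (z - 1) / exp (\<rho> * t powr \<gamma>))) \<partial>lebesgue_on {0<..})"
    using c \<rho> by (intro nn_integral_cong, subst ennreal_mult[symmetric]) (auto simp: eq space_restrict_space)
  also have "\<dots> = ennreal (1 / c) * (\<integral>\<^sup>+t. ennreal (\<bar>\<rho> * (\<gamma> * t powr (\<gamma> - 1))\<bar>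
            * ((\<rho> * t powr \<gamma>) powr (z - 1) / exp (\<rho> * t powr \<gamma>))) \<partial>lebesgue_on {0<..})"
    using \<rho> by (intro nn_integral_cmult measurable_compose[OF _ measurable_ennreal]
        continuous_imp_measurable_on_sets_lebesgue) (auto intro!: continuous_intros)
  also have "\<dots> \<le> ennreal (1 / c) * (\<integral>\<^sup>+t. ennreal (t powr (z - 1) / exp t) \<partial>lebesgue_on {0<..})"
    using \<rho> \<gamma>
    by (intro mult_left_mono nn_integral_substitution_le meas)
       (auto intro!: derivative_eq_intros inj_onI dest: powr_left_inj)
  also have "\<dots> < \<infinity>" using fin by (simp add: ennreal_mult_less_top)
  finally show ?thesis .
qed

lemma k_eq: "k \<alpha> \<rho> \<gamma> \<sigma> = (\<integral>\<^sup>+t. ennreal (weighted_profile \<alpha> \<rho> \<gamma> \<sigma> t) \<partial>lebesgue_on {0<..})"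
  by (simp add: k_def weighted_profile_def profile_def)

text \<open>
  Near \<open>0\<close> the integrand behaves like \<open>t powr (\<sigma> - \<gamma> - 1)\<close>; this is integrable
  because \<open>\<gamma> < \<sigma>\<close>.
\<close>

lemma k_finite: "k \<alpha> \<rho> \<gamma> \<sigma> < \<infinity>"
proof -
  have le: "weighted_profile \<alpha> \<rho> \<gamma> \<sigma> t
      \<le> 1 / \<rho> * (t powr (\<sigma> - \<gamma> - 1) / exp (\<rho> * t powr \<gamma>)) + 2 * (t powr (\<sigma> - 1) / exp (\<rho> * t powr \<gamma>))"
    if t: "t > 0" for t
  proof -
    define u where "u = \<rho> * t powr \<gamma>"
    have u: "u > 0" using \<rho> t by (simp add: u_def)
    have "profile \<alpha> \<rho> \<gamma> t \<le> csch u / 1"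
      unfolding profile_def u_def[symmetric] using \<alpha> u t
      by (intro divide_left_mono) (auto intro!: less_imp_le[OF csch_pos])
    also have "\<dots> \<le> (1 / u + 2) / exp u" using csch_le[OF u] by simp
    finally have "weighted_profile \<alpha> \<rho> \<gamma> \<sigma> t \<le> (1 / u + 2) / exp u * t powr (\<sigma> - 1)"
      unfolding weighted_profile_def by (intro mult_right_mono) auto
    also have "\<dots> = 1 / \<rho> * (t powr (\<sigma> - 1) / t powr \<gamma> / exp u) + 2 * (t powr (\<sigma> - 1) / exp u)"
      using \<rho> t by (simp add: u_def field_simps)
    also have "t powr (\<sigma> - 1) / t powr \<gamma> = t powr (\<sigma> - \<gamma> - 1)"
      by (simp add: algebra_simps flip: powr_diff)
    finally show ?thesis by (simp add: u_def)
  qed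
  have meas: "(\<lambda>t. t powr (s - 1) / exp (\<rho> * t powr \<gamma>)) \<in> borel_measurable (lebesgue_on {0<..})" for s
    by (intro continuous_imp_measurable_on_sets_lebesgue) (auto intro!: continuous_intros)
  have "k \<alpha> \<rho> \<gamma> \<sigma> \<le> (\<integral>\<^sup>+t. ennreal (1 / \<rho>) * ennreal (t powr (\<sigma> - \<gamma> - 1) / exp (\<rho> * t powr \<gamma>))
      + ennreal 2 * ennreal (t powr (\<sigma> - 1) / exp (\<rho> * t powr \<gamma>)) \<partial>lebesgue_on {0<..})"
    unfolding k_eq
  proof (intro nn_integral_mono)
    fix t :: real assume "t \<in> space (lebesgue_on {0<..})"
    then have "t > 0" by (simp add: space_restrict_space)
    then show "ennreal (weighted_profile \<alpha> \<rho> \<gamma> \<sigma> t)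
      \<le> ennreal (1 / \<rho>) * ennreal (t powr (\<sigma> - \<gamma> - 1) / exp (\<rho> * t powr \<gamma>))
        + ennreal 2 * ennreal (t powr (\<sigma> - 1) / exp (\<rho> * t powr \<gamma>))"
      using le \<rho> by (simp add: ennreal_leI del: ennreal_numeral flip: ennreal_mult ennreal_plus)
  qed
  also have "\<dots> = ennreal (1 / \<rho>) * (\<integral>\<^sup>+t. ennreal (t powr (\<sigma> - \<gamma> - 1) / exp (\<rho> * t powr \<gamma>)) \<partial>lebesgue_on {0<..})
      + ennreal 2 * (\<integral>\<^sup>+t. ennreal (t powr (\<sigma> - 1) / exp (\<rho> * t powr \<gamma>)) \<partial>lebesgue_on {0<..})"
    using meas by (subst nn_integral_add) (auto simp: nn_integral_cmult)
  also have "\<dots> < \<infinity>"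
    using nn_integral_powr_exp_powr_finite[of "\<sigma> - \<gamma>"] nn_integral_powr_exp_powr_finite[of \<sigma>] \<gamma> \<gamma>\<sigma>
    by (simp add: ennreal_mult_less_top)
  finally show ?thesis .
qed

text \<open>
  The weight function of the discrete variable. The points \<open>c V n\<close> cut the half-line,
  or an initial part of it, into intervals of length \<open>c \<nu> n\<close>, and \<open>\<nu>t n \<le> \<nu> n / 2\<close> says exactly that the sampling point
  \<open>c Vt n\<close> is not to the left of the midpoint of the \<open>n\<close>-th interval.
\<close>

lemma suminf_profile_less:
  assumes \<nu>: "\<And>n. n \<ge> 1 \<Longrightarrow> \<nu> n > 0" and \<nu>t: "\<And>n. n \<ge> 1 \<Longrightarrow> 0 \<le> \<nu>t n \<and> \<nu>t n \<le> \<nu> n / 2"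
    and c: "c > 0"
  shows "(\<Sum>n. ennreal (c * \<nu> (Suc n) * weighted_profile \<alpha> \<rho> \<gamma> \<sigma> (c * Vt \<nu> \<nu>t (Suc n)))) < k \<alpha> \<rho> \<gamma> \<sigma>"
proof -
  have V_Suc: "V \<nu> (Suc n) = V \<nu> n + \<nu> (Suc n)" for n by (simp add: V_def)
  have V_Vt: "(V \<nu> n + V \<nu> (Suc n)) / 2 \<le> Vt \<nu> \<nu>t (Suc n)" for n
    using \<nu>t[of "Suc n"] by (simp add: Vt_def V_Suc field_simps)
  have "(\<Sum>n. ennreal ((c * V \<nu> (Suc n) - c * V \<nu> n) * weighted_profile \<alpha> \<rho> \<gamma> \<sigma> (c * Vt \<nu> \<nu>t (Suc n))))
      < (\<integral>\<^sup>+t. ennreal (weighted_profile \<alpha> \<rho> \<gamma> \<sigma> t) \<partial>lebesgue_on {0<..})"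
  proof (rule suminf_midpoints_less_nn_integral)
    show "(c * V \<nu> n + c * V \<nu> (Suc n)) / 2 \<le> c * Vt \<nu> \<nu>t (Suc n)" for n
      using mult_left_mono[OF V_Vt[of n]] c by (simp add: distrib_left)
  qed (use c \<nu> k_finite in \<open>auto simp: strict_midpoint_convex_weighted_profile
      continuous_on_weighted_profile antimono_on_weighted_profile weighted_profile_pos less_imp_le
      V_Suc k_eq V_def\<close>)
  then show ?thesis by (simp add: k_eq V_Suc algebra_simps)
qed

end

section \<open>The primitive of the weight\<close>

context
  fixes \<mu> :: "real \<Rightarrow> real"
  assumes cont_\<mu>: "continuous_on {0<..} \<mu>" and \<mu>_pos: "\<And>x. x > 0 \<Longrightarrow> \<mu> x > 0"
    and int_\<mu>: "\<And>x. x > 0 \<Longrightarrow> integrable (lebesgue_on {0<..x}) \<mu>"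
begin

lemma U_eq_add_integral:
  assumes "0 < a" "a \<le> y"
  shows "U \<mu> y = U \<mu> a + integral {a..y} \<mu>"
proof -
  have hi: "(\<mu> has_integral U \<mu> z) {0<..z}" if "z > 0" for z
    unfolding U_def using int_\<mu>[OF that] by (intro has_integral_integral_lebesgue_on) auto
  have "continuous_on {a..y} \<mu>"
    using assms by (intro continuous_on_subset[OF cont_\<mu>]) auto
  then have "(\<mu> has_integral integral {a..y} \<mu>) {a..y}"
    by (intro integrable_integral integrable_continuous_interval)
  moreover have "{0<..a} \<inter> {a..y} = {a}" "{0<..a} \<union> {a..y} = {0<..y}" using assms by auto
  ultimately have "(\<mu> has_integral U \<mu> a + integral {a..y} \<mu>) {0<..y}"
    using has_integral_Un[OF hi[OF assms(1)], of _ "{a..y}"] by simp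
  with hi[of y] assms show ?thesis by (intro has_integral_unique[of \<mu> _ "{0<..y}"]) auto
qed

lemma U_has_field_derivative:
  assumes x: "x > 0"
  shows "(U \<mu> has_field_derivative \<mu> x) (at x)"
proof -
  define a b where "a = x / 2" and "b = x + 1"
  have ab: "0 < a" "x \<in> {a<..<b}" using x by (auto simp: a_def b_def)
  have "continuous_on {a..b} \<mu>"
    using ab by (intro continuous_on_subset[OF cont_\<mu>]) auto
  then have "((\<lambda>y. integral {a..y} \<mu>) has_vector_derivative \<mu> x) (at x within {a..b})"
    using ab by (intro integral_has_vector_derivative) auto
  moreover have "at x within {a..b} = at x"
    using ab by (intro at_within_interior) (simp only: interior_atLeastAtMost_real)
  ultimately have "((\<lambda>y. integral {a..y} \<mu>) has_field_derivative \<mu> x) (at x)"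
    by (simp only: has_real_derivative_iff_has_vector_derivative)
  then have "((\<lambda>y. U \<mu> a + integral {a..y} \<mu>) has_field_derivative 0 + \<mu> x) (at x)"
    by (intro DERIV_add DERIV_const)
  then have "((\<lambda>y. U \<mu> a + integral {a..y} \<mu>) has_field_derivative \<mu> x) (at x)"
    by simp
  then show ?thesis
    by (rule has_field_derivative_transform_within_open[of _ _ _ "{a<..<b}"])
       (use ab in \<open>auto intro!: U_eq_add_integral[symmetric]\<close>)
qed

lemma U_less:
  assumes "0 < x" "x < y" shows "U \<mu> x < U \<mu> y"
  using assms by (intro DERIV_pos_imp_increasing[of x y "U \<mu>"])
    (auto intro!: exI[of _ "\<mu> _"] U_has_field_derivative \<mu>_pos)

lemma U_pos:
  assumes "0 < x" shows "0 < U \<mu> x"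
proof -
  have "0 \<le> U \<mu> (x / 2)"
    unfolding U_def using \<mu>_pos by (intro integral_nonneg_AE AE_I2) (auto simp: space_restrict_space less_imp_le)
  also have "\<dots> < U \<mu> x" using assms by (intro U_less) auto
  finally show ?thesis .
qed

lemma continuous_on_U: "continuous_on {0<..} (U \<mu>)"
  by (rule DERIV_continuous_on[of _ _ \<mu>], rule has_field_derivative_at_within, rule U_has_field_derivative) simp

text \<open>
  The weight function of the continuous variable: substitute \<open>t = U(x) powr \<delta> \<cdot> v\<close> in \<open>k \<sigma>\<close>. As
  \<open>\<bar>\<delta>\<bar> = 1\<close>, one has \<open>\<bar>dt / dx\<bar> = t \<cdot> \<mu> x / U x\<close> for both signs of \<open>\<delta>\<close>.
\<close>

lemma nn_integral_profile_le_k: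
  assumes "0 \<le> \<alpha>" "0 < \<rho>" "0 < \<gamma>" "\<gamma> < \<sigma>" "\<sigma> \<le> 1" and \<delta>: "\<delta> \<in> {-1, 1}" and v: "v > 0"
  shows "(\<integral>\<^sup>+x. ennreal (profile \<alpha> \<rho> \<gamma> (U \<mu> x powr \<delta> * v) * (U \<mu> x powr \<delta> * v) powr \<sigma> * (\<mu> x / U \<mu> x))
            \<partial>lebesgue_on {0<..}) \<le> k \<alpha> \<rho> \<gamma> \<sigma>"
proof -
  define g g' where "g x = U \<mu> x powr \<delta> * v" and "g' x = \<delta> * U \<mu> x powr (\<delta> - 1) * \<mu> x * v" for x
  have g_pos: "g x > 0" if "x > 0" for x using U_pos[OF that] v by (simp add: g_def)
  have der: "(g has_field_derivative g' x) (at x within {0<..})" if "x \<in> {0<..}" for x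
    unfolding g_def[abs_def] g'_def using that U_pos[of x]
    by (auto intro!: derivative_eq_intros has_field_derivative_at_within[OF U_has_field_derivative])
  have inj: "inj_on g {0<..}"
  proof (rule inj_onI)
    fix x y :: real assume xy: "x \<in> {0<..}" "y \<in> {0<..}" "g x = g y"
    then have "U \<mu> x = U \<mu> y"
      using v \<delta> U_pos[of x] U_pos[of y]
      by (intro powr_left_inj[of "U \<mu> x" \<delta> "U \<mu> y"]) (auto simp: g_def)
    then show "x = y" using U_less[of x y] U_less[of y x] xy by (cases x y rule: linorder_cases) auto
  qed
  have eq: "profile \<alpha> \<rho> \<gamma> (U \<mu> x powr \<delta> * v) * (U \<mu> x powr \<delta> * v) powr \<sigma> * (\<mu> x / U \<mu> x)
      = \<bar>g' x\<bar> * weighted_profile \<alpha> \<rho> \<gamma> \<sigma> (g x)" if "x > 0" for x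
  proof -
    have g': "\<bar>g' x\<bar> = g x * (\<mu> x / U \<mu> x)"
      using \<delta> U_pos[OF that] \<mu>_pos[OF that] v by (auto simp: g'_def g_def abs_mult powr_diff)
    have "g x powr \<sigma> = g x * g x powr (\<sigma> - 1)"
      using powr_add[of "g x" 1 "\<sigma> - 1"] g_pos[OF that] by simp
    then show ?thesis
      unfolding weighted_profile_def g_def[symmetric] g' by (simp add: mult_ac)
  qed
  have "(\<integral>\<^sup>+x. ennreal (profile \<alpha> \<rho> \<gamma> (U \<mu> x powr \<delta> * v) * (U \<mu> x powr \<delta> * v) powr \<sigma> * (\<mu> x / U \<mu> x))
            \<partial>lebesgue_on {0<..})
      = (\<integral>\<^sup>+x. ennreal (\<bar>g' x\<bar> * weighted_profile \<alpha> \<rho> \<gamma> \<sigma> (g x)) \<partial>lebesgue_on {0<..})"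
    by (intro nn_integral_cong arg_cong[where f=ennreal] eq) (simp add: space_restrict_space)
  also have "\<dots> \<le> (\<integral>\<^sup>+t. ennreal (weighted_profile \<alpha> \<rho> \<gamma> \<sigma> t) \<partial>lebesgue_on {0<..})"
    using der inj g_pos assms
    by (intro nn_integral_substitution_le continuous_imp_measurable_on_sets_lebesgue
          continuous_on_weighted_profile less_imp_le[OF weighted_profile_pos]) auto
  finally show ?thesis
    using assms by (subst k_eq) auto
qed

end

section \<open>The Hilbert-type inequalities\<close>

lemma sigma_finite_completion:
  assumes "sigma_finite_measure M" shows "sigma_finite_measure (completion M)"
proof -
  interpret sigma_finite_measure M by fact
  obtain C where "countable C" "C \<subseteq> sets M" "\<Union>C = space M" "\<forall>a\<in>C. emeasure M a \<noteq> \<infinity>"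
    using sigma_finite_countable by blast
  then show ?thesis by unfold_locales (intro exI[of _ C], auto)
qed

theorem theorem1:
  fixes \<alpha> \<rho> \<gamma> \<sigma> \<delta> p q :: real
    and \<mu> f :: "real \<Rightarrow> real"
    and \<nu> \<nu>t a :: "nat \<Rightarrow> real"
  assumes "\<And>n. n \<ge> 1 \<Longrightarrow> \<nu> n > 0"
    and "\<And>n. n \<ge> 1 \<Longrightarrow> 0 \<le> \<nu>t n \<and> \<nu>t n \<le> \<nu> n / 2"
    and "continuous_on {0<..} \<mu>"
    and "\<And>x. x > 0 \<Longrightarrow> \<mu> x > 0"
    and "\<And>x. x > 0 \<Longrightarrow> integrable (lebesgue_on {0<..x}) \<mu>"
    and "0 \<le> \<alpha>" and "\<alpha> \<le> \<rho>" and "\<rho> > 0"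
    and "0 < \<gamma>" and "\<gamma> < \<sigma>" and "\<sigma> \<le> 1"
    and "\<delta> \<in> {-1, 1}"
    and "p > 1" and "1 / p + 1 / q = 1"
    and "f \<in> borel_measurable (lebesgue_on {0<..})"
    and "\<And>x. x > 0 \<Longrightarrow> f x \<ge> 0"
    and "\<And>n. n \<ge> 1 \<Longrightarrow> a n \<ge> 0"
    and "0 < wnorm_fun p (\<Phi> p \<sigma> \<delta> \<mu>) f" and "wnorm_fun p (\<Phi> p \<sigma> \<delta> \<mu>) f < \<infinity>"
    and "0 < wnorm_seq q (\<Psi>t q \<sigma> \<nu> \<nu>t) a" and "wnorm_seq q (\<Psi>t q \<sigma> \<nu> \<nu>t) a < \<infinity>"
  shows
    "(\<Sum>n. \<integral>\<^sup>+x. ennreal (H \<alpha> \<rho> \<gamma> \<delta> \<mu> \<nu> \<nu>t x (Suc n) * a (Suc n) * f x) \<partial>lebesgue_on {0<..})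
       < k \<alpha> \<rho> \<gamma> \<sigma> * wnorm_fun p (\<Phi> p \<sigma> \<delta> \<mu>) f * wnorm_seq q (\<Psi>t q \<sigma> \<nu> \<nu>t) a
     \<and>
     epowr (\<Sum>n. ennreal (\<nu> (Suc n) / Vt \<nu> \<nu>t (Suc n) powr (1 - p * \<sigma>))
              * epowr (\<integral>\<^sup>+x. ennreal (H \<alpha> \<rho> \<gamma> \<delta> \<mu> \<nu> \<nu>t x (Suc n) * f x) \<partial>lebesgue_on {0<..}) p)
           (1 / p)
       < k \<alpha> \<rho> \<gamma> \<sigma> * wnorm_fun p (\<Phi> p \<sigma> \<delta> \<mu>) f
     \<and>
     epowr (\<integral>\<^sup>+x. ennreal (\<mu> x / U \<mu> x powr (1 - q * \<delta> * \<sigma>))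
              * epowr (\<Sum>n. ennreal (H \<alpha> \<rho> \<gamma> \<delta> \<mu> \<nu> \<nu>t x (Suc n) * a (Suc n))) q
              \<partial>lebesgue_on {0<..})
           (1 / q)
       < k \<alpha> \<rho> \<gamma> \<sigma> * wnorm_seq q (\<Psi>t q \<sigma> \<nu> \<nu>t) a"
proof -
  note \<nu>_pos = assms(1) and \<nu>t = assms(2) and cont_\<mu> = assms(3) and \<mu>_pos = assms(4) and int_\<mu> = assms(5)
    and f_nonneg = assms(16) and a_nonneg = assms(17)
  note parameters = \<open>0 \<le> \<alpha>\<close> \<open>\<rho> > 0\<close> \<open>0 < \<gamma>\<close> \<open>\<gamma> < \<sigma>\<close> \<open>\<sigma> \<le> 1\<close>
  note p = \<open>p > 1\<close> and pq = \<open>1 / p + 1 / q = 1\<close>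
  have q: "q > 1" using conjugate_exponent_gt_1[OF p pq] .
  define u where "u = U \<mu>"
  define w c where "w n = Vt \<nu> \<nu>t (Suc n)" and "c n = \<nu> (Suc n)" for n
  define \<kappa> where "\<kappa> = k \<alpha> \<rho> \<gamma> \<sigma>"
  define l where "l x n = profile \<alpha> \<rho> \<gamma> (u x powr \<delta> * w n) * (u x powr \<delta> * w n) powr \<sigma>" for x n
  have u_pos: "u x > 0" if "x > 0" for x
    using U_pos[OF cont_\<mu> \<mu>_pos int_\<mu> that] by (simp add: u_def)
  have c_pos: "c n > 0" for n using \<nu>_pos by (simp add: c_def)
  have w_pos: "w n > 0" for n
  proof -
    have "w n = V \<nu> n + (\<nu> (Suc n) - \<nu>t (Suc n))" by (simp add: w_def Vt_def V_def)
    moreover have "V \<nu> n \<ge> 0" unfolding V_def using \<nu>_pos by (intro sum_nonneg) (auto intro: less_imp_le)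
    ultimately show ?thesis using \<nu>t[of "Suc n"] \<nu>_pos[of "Suc n"] by simp
  qed
  have profile_nn: "profile \<alpha> \<rho> \<gamma> (u x powr \<delta> * w n) > 0" if "x > 0" for x n
    using profile_pos[OF parameters] u_pos[OF that] w_pos[of n] by simp
  have l_pos: "l x n > 0" if "x > 0" for x n
    using profile_nn[OF that] u_pos[OF that] w_pos[of n] by (simp add: l_def)
  have H_eq: "H \<alpha> \<rho> \<gamma> \<delta> \<mu> \<nu> \<nu>t x (Suc n) = profile \<alpha> \<rho> \<gamma> (u x powr \<delta> * w n)" for x n
    by (simp add: H_def profile_def u_def w_def)
  have l_H: "l x n = profile \<alpha> \<rho> \<gamma> (u x powr \<delta> * w n) * (u x powr (\<delta> * \<sigma>) * w n powr \<sigma>)" if "x > 0" for x n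
    using u_pos[OF that] w_pos[of n] by (simp add: l_def powr_mult powr_powr)

  \<comment> \<open>The weights move into the measures \<open>M\<close>, \<open>N\<close> and into the functions \<open>F\<close>, \<open>G\<close>. The powers are
    chosen so that the kernel turns into a function of \<open>u x powr \<delta> \<cdot> w n\<close> alone, for which
    both marginals are bounded by the same constant. The index \<open>n\<close> stands for the positive integer \<open>Suc n\<close>.\<close>
  define \<Lambda> where "\<Lambda> = lebesgue_on {0::real<..}"
  define M where "M = density \<Lambda> (\<lambda>x. ennreal (\<mu> x / u x))"
  define N where "N = density (count_space UNIV) (\<lambda>n. ennreal (c n / w n))"
  define F where "F x = ennreal (f x * u x powr (1 - \<delta> * \<sigma>) / \<mu> x)" for x
  define G where "G n = ennreal (a (Suc n) * w n powr (1 - \<sigma>) / c n)" for n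
  have space_\<Lambda>: "space \<Lambda> = {0<..}" by (simp add: \<Lambda>_def space_restrict_space)
  have [measurable]: "u \<in> borel_measurable \<Lambda>" "\<mu> \<in> borel_measurable \<Lambda>" "f \<in> borel_measurable \<Lambda>"
    unfolding \<Lambda>_def u_def using assms(15) continuous_on_U[OF cont_\<mu> \<mu>_pos int_\<mu>] cont_\<mu>
    by (auto intro!: continuous_imp_measurable_on_sets_lebesgue)
  have [measurable]: "(\<lambda>x. ennreal (l x n)) \<in> borel_measurable \<Lambda>" for n
    unfolding l_def profile_def csch_def by measurable
  have [measurable]: "F \<in> borel_measurable \<Lambda>" unfolding F_def by measurable
  have meas_pair: "(\<lambda>(n, x). ennreal (l x n)) \<in> borel_measurable (count_space UNIV \<Otimes>\<^sub>M \<Lambda>)"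
    by (rule measurable_pair_measure_countable1) auto
  have sets_pair: "sets (N \<Otimes>\<^sub>M M) = sets (count_space UNIV \<Otimes>\<^sub>M \<Lambda>)" 
    by (intro sets_pair_measure_cong) (auto simp: M_def N_def)
  have L_NM: "(\<lambda>(n, x). ennreal (l x n)) \<in> borel_measurable (N \<Otimes>\<^sub>M M)"
    using meas_pair by (simp cong: measurable_cong_sets add: measurable_cong_sets[OF sets_pair refl])
  have L_MN: "(\<lambda>(x, n). ennreal (l x n)) \<in> borel_measurable (M \<Otimes>\<^sub>M N)"
    using measurable_pair_swap[OF L_NM] by (simp add: case_prod_unfold)
  have int_M: "(\<integral>\<^sup>+x. h x \<partial>M) = (\<integral>\<^sup>+x. ennreal (\<mu> x / u x) * h x \<partial>\<Lambda>)"
    if "h \<in> borel_measurable \<Lambda>" for h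
    unfolding M_def using that by (intro nn_integral_density) measurable
  have int_N: "(\<integral>\<^sup>+n. h n \<partial>N) = (\<Sum>n. ennreal (c n / w n) * h n)" for h
    unfolding N_def by (subst nn_integral_density) (auto simp: nn_integral_count_space_nat)
  have sfM: "sigma_finite_measure M"
  proof -
    have "sigma_finite_measure \<Lambda>"
      unfolding \<Lambda>_def by (intro sigma_finite_measure_restrict_space sigma_finite_completion lborel.sigma_finite_measure_axioms) auto
    then show ?thesis
      unfolding M_def by (subst sigma_finite_measure.sigma_finite_iff_density_finite) auto
  qed
  have sfN: "sigma_finite_measure N"
    unfolding N_def
    by (subst sigma_finite_measure.sigma_finite_iff_density_finite) (auto intro: sigma_finite_measure_count_space)

  \<comment> \<open>The two marginals. Only the second one is strictly below \<open>\<kappa>\<close> in general.\<close>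
  have row: "(\<integral>\<^sup>+x. ennreal (l x n) \<partial>M) \<le> \<kappa>" for n
  proof -
    have "(\<integral>\<^sup>+x. ennreal (l x n) \<partial>M) = (\<integral>\<^sup>+x. ennreal (l x n * (\<mu> x / u x)) \<partial>\<Lambda>)"
      using l_pos u_pos \<mu>_pos
      by (subst int_M)
         (auto intro!: nn_integral_cong simp: space_\<Lambda> mult.commute less_imp_le simp flip: ennreal_mult)
    also have "\<dots> \<le> \<kappa>"
      unfolding \<Lambda>_def l_def u_def \<kappa>_def
      by (intro nn_integral_profile_le_k[OF cont_\<mu> \<mu>_pos int_\<mu>] parameters \<open>\<delta> \<in> {-1, 1}\<close> w_pos)
    finally show ?thesis .
  qed
  have col: "(\<integral>\<^sup>+n. ennreal (l x n) \<partial>N) < \<kappa>" if "x > 0" for x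
  proof -
    define t where "t = u x powr \<delta>"
    have t: "t > 0" using u_pos[OF that] by (simp add: t_def)
    have "ennreal (c n / w n) * ennreal (l x n) = ennreal (t * c n * weighted_profile \<alpha> \<rho> \<gamma> \<sigma> (t * w n))" for n
    proof -
      have "(t * w n) powr \<sigma> = t * w n * (t * w n) powr (\<sigma> - 1)"
        using powr_add[of "t * w n" 1 "\<sigma> - 1"] t w_pos[of n] by simp
      then show ?thesis
        using t w_pos[of n] c_pos[of n] l_pos[OF that, of n]
        by (simp add: l_def weighted_profile_def t_def mult_ac flip: ennreal_mult)
    qed
    then show ?thesis
      using suminf_profile_less[OF parameters \<nu>_pos \<nu>t t] by (simp add: int_N c_def w_def \<kappa>_def)
  qed
  have "0 < \<kappa>" using col[of 1] by (simp add: le_less_trans)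
  have "\<kappa> < \<infinity>" unfolding \<kappa>_def using k_finite[OF parameters] .

  \<comment> \<open>The weighted norms are the \<open>L\<^sup>p(M)\<close> norm of \<open>F\<close> and the \<open>L\<^sup>q(N)\<close> norm of \<open>G\<close>.\<close>
  have F_norm: "wnorm_fun p (\<Phi> p \<sigma> \<delta> \<mu>) f = epowr (\<integral>\<^sup>+x. epowr (F x) p \<partial>M) (1 / p)"
  proof -
    have "ennreal (\<Phi> p \<sigma> \<delta> \<mu> x * f x powr p) = ennreal (\<mu> x / u x) * epowr (F x) p" if "x > 0" for x
    proof -
      note pos = u_pos[OF that] \<mu>_pos[OF that]
      have "(f x * u x powr (1 - \<delta> * \<sigma>) / \<mu> x) powr p = f x powr p * u x powr (p * (1 - \<delta> * \<sigma>)) / \<mu> x powr p"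
        using pos f_nonneg[OF that] by (simp add: powr_mult powr_divide powr_powr mult.commute)
      then show ?thesis
        using pos f_nonneg[OF that]
        by (simp add: F_def \<Phi>_def epowr_ennreal u_def[symmetric] powr_diff mult_ac flip: ennreal_mult)
    qed
    then show ?thesis
      unfolding wnorm_fun_def \<Lambda>_def[symmetric]
      by (subst int_M) (auto intro!: arg_cong[where f="\<lambda>I. epowr I _"] nn_integral_cong simp: space_\<Lambda>)
  qed
  have G_norm: "wnorm_seq q (\<Psi>t q \<sigma> \<nu> \<nu>t) a = epowr (\<integral>\<^sup>+n. epowr (G n) q \<partial>N) (1 / q)"
  proof -
    have "ennreal (\<Psi>t q \<sigma> \<nu> \<nu>t (Suc n) * a (Suc n) powr q) = ennreal (c n / w n) * epowr (G n) q" for n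
    proof -
      note pos = w_pos[of n] c_pos[of n] and an = a_nonneg[of "Suc n"]
      have "(a (Suc n) * w n powr (1 - \<sigma>) / c n) powr q
          = a (Suc n) powr q * w n powr (q * (1 - \<sigma>)) / c n powr q"
        using pos an by (simp add: powr_mult powr_divide powr_powr mult.commute)
      then show ?thesis
        using pos an
        by (simp add: G_def \<Psi>t_def epowr_ennreal w_def[symmetric] c_def[symmetric] powr_diff mult_ac flip: ennreal_mult)
    qed
    then show ?thesis unfolding wnorm_seq_def by (simp add: int_N)
  qed
  have F_int: "0 < (\<integral>\<^sup>+x. epowr (F x) p \<partial>M)" "(\<integral>\<^sup>+x. epowr (F x) p \<partial>M) < \<infinity>"
    using assms(18,19) unfolding F_norm by (auto simp: zero_less_iff_neq_zero less_top[symmetric])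
  have G_int: "0 < (\<integral>\<^sup>+n. epowr (G n) q \<partial>N)" "(\<integral>\<^sup>+n. epowr (G n) q \<partial>N) < \<infinity>"
    using assms(20,21) unfolding G_norm by (auto simp: zero_less_iff_neq_zero less_top[symmetric])

  \<comment> \<open>The transforms of \<open>F\<close> and \<open>G\<close> are the inner integral \<open>A n\<close> and the inner sum \<open>B x\<close>
    of the theorem, up to a power of \<open>w n\<close> and of \<open>u x\<close> respectively.\<close>
  define A where "A n = (\<integral>\<^sup>+x. ennreal (H \<alpha> \<rho> \<gamma> \<delta> \<mu> \<nu> \<nu>t x (Suc n) * f x) \<partial>\<Lambda>)" for n
  define B where "B x = (\<Sum>n. ennreal (H \<alpha> \<rho> \<gamma> \<delta> \<mu> \<nu> \<nu>t x (Suc n) * a (Suc n)))" for x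
  have [measurable]: "(\<lambda>x. ennreal (H \<alpha> \<rho> \<gamma> \<delta> \<mu> \<nu> \<nu>t x (Suc n) * f x)) \<in> borel_measurable \<Lambda>" for n
    unfolding H_eq profile_def csch_def by measurable
  have TF: "(\<integral>\<^sup>+x. ennreal (l x n) * F x \<partial>M) = ennreal (w n powr \<sigma>) * A n" for n
  proof -
    have "ennreal (\<mu> x / u x) * (ennreal (l x n) * F x)
        = ennreal (w n powr \<sigma>) * ennreal (H \<alpha> \<rho> \<gamma> \<delta> \<mu> \<nu> \<nu>t x (Suc n) * f x)" if "x > 0" for x
    proof -
      note pos = u_pos[OF that] \<mu>_pos[OF that] w_pos[of n] f_nonneg[OF that] profile_nn[OF that, of n]
      have "\<mu> x / u x * (l x n * (f x * u x powr (1 - \<delta> * \<sigma>) / \<mu> x))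
          = w n powr \<sigma> * (profile \<alpha> \<rho> \<gamma> (u x powr \<delta> * w n) * f x)"
        using pos by (simp add: l_H[OF that] powr_diff)
      then show ?thesis
        using pos l_pos[OF that, of n] by (simp add: F_def H_eq flip: ennreal_mult)
    qed
    then show ?thesis
      unfolding A_def by (subst int_M) (auto intro!: nn_integral_cong simp: space_\<Lambda> simp flip: nn_integral_cmult)
  qed
  have SG: "(\<integral>\<^sup>+n. ennreal (l x n) * G n \<partial>N) = ennreal (u x powr (\<delta> * \<sigma>)) * B x" if "x > 0" for x
  proof -
    have "ennreal (c n / w n) * (ennreal (l x n) * G n)
        = ennreal (u x powr (\<delta> * \<sigma>)) * ennreal (H \<alpha> \<rho> \<gamma> \<delta> \<mu> \<nu> \<nu>t x (Suc n) * a (Suc n))" for n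
    proof -
      note pos = u_pos[OF that] c_pos[of n] w_pos[of n] a_nonneg[of "Suc n"] profile_nn[OF that, of n]
      have "c n / w n * (l x n * (a (Suc n) * w n powr (1 - \<sigma>) / c n))
          = u x powr (\<delta> * \<sigma>) * (profile \<alpha> \<rho> \<gamma> (u x powr \<delta> * w n) * a (Suc n))"
        using pos by (simp add: l_H[OF that] powr_diff)
      then show ?thesis
        using pos l_pos[OF that, of n] by (simp add: G_def H_eq flip: ennreal_mult)
    qed
    then show ?thesis by (simp add: int_N B_def)
  qed

  \<comment> \<open>The three left-hand sides, in terms of the transformed kernel.\<close>
  have J1: "epowr (\<Sum>n. ennreal (c n / w n powr (1 - p * \<sigma>)) * epowr (A n) p) (1 / p)
      = epowr (\<integral>\<^sup>+n. epowr (\<integral>\<^sup>+x. ennreal (l x n) * F x \<partial>M) p \<partial>N) (1 / p)"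
  proof -
    have "ennreal (c n / w n) * epowr (ennreal (w n powr \<sigma>) * A n) p
        = ennreal (c n / w n powr (1 - p * \<sigma>)) * epowr (A n) p" for n
    proof -
      have "epowr (ennreal (w n powr \<sigma>) * A n) p = ennreal (w n powr (p * \<sigma>)) * epowr (A n) p"
        using p by (simp add: epowr_mult epowr_ennreal powr_powr mult.commute[of p])
      moreover have "c n / w n * w n powr (p * \<sigma>) = c n / w n powr (1 - p * \<sigma>)"
        using w_pos[of n] by (simp add: powr_diff)
      ultimately show ?thesis
        using w_pos[of n] c_pos[of n] by (simp flip: ennreal_mult mult.assoc)
    qed
    then show ?thesis by (simp add: TF int_N)
  qed
  have J2: "epowr (\<integral>\<^sup>+x. ennreal (\<mu> x / u x powr (1 - q * \<delta> * \<sigma>)) * epowr (B x) q \<partial>\<Lambda>) (1 / q)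
      = epowr (\<integral>\<^sup>+x. epowr (\<integral>\<^sup>+n. ennreal (l x n) * G n \<partial>N) q \<partial>M) (1 / q)"
  proof -
    have "ennreal (\<mu> x / u x) * epowr (ennreal (u x powr (\<delta> * \<sigma>)) * B x) q
        = ennreal (\<mu> x / u x powr (1 - q * \<delta> * \<sigma>)) * epowr (B x) q" if "x > 0" for x
    proof -
      have "epowr (ennreal (u x powr (\<delta> * \<sigma>)) * B x) q = ennreal (u x powr (q * \<delta> * \<sigma>)) * epowr (B x) q"
        using q by (simp add: epowr_mult epowr_ennreal powr_powr mult_ac)
      moreover have "\<mu> x / u x * u x powr (q * \<delta> * \<sigma>) = \<mu> x / u x powr (1 - q * \<delta> * \<sigma>)"
        using u_pos[OF that] by (simp add: powr_diff)
      ultimately show ?thesis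
        using u_pos[OF that] \<mu>_pos[OF that] by (simp flip: ennreal_mult mult.assoc)
    qed
    moreover have "(\<lambda>x. epowr (\<integral>\<^sup>+n. ennreal (l x n) * G n \<partial>N) q) \<in> borel_measurable \<Lambda>"
      unfolding int_N by measurable
    ultimately show ?thesis
      by (subst int_M) (auto intro!: arg_cong[where f="\<lambda>I. epowr I _"] nn_integral_cong simp: space_\<Lambda> SG)
  qed
  have I: "(\<Sum>n. \<integral>\<^sup>+x. ennreal (H \<alpha> \<rho> \<gamma> \<delta> \<mu> \<nu> \<nu>t x (Suc n) * a (Suc n) * f x) \<partial>\<Lambda>)
      = (\<integral>\<^sup>+n. (\<integral>\<^sup>+x. ennreal (l x n) * F x \<partial>M) * G n \<partial>N)"
  proof -
    have "(\<integral>\<^sup>+x. ennreal (H \<alpha> \<rho> \<gamma> \<delta> \<mu> \<nu> \<nu>t x (Suc n) * a (Suc n) * f x) \<partial>\<Lambda>)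
        = ennreal (c n / w n) * ((ennreal (w n powr \<sigma>) * A n) * G n)" for n
    proof -
      have "(\<integral>\<^sup>+x. ennreal (H \<alpha> \<rho> \<gamma> \<delta> \<mu> \<nu> \<nu>t x (Suc n) * a (Suc n) * f x) \<partial>\<Lambda>)
          = (\<integral>\<^sup>+x. ennreal (a (Suc n)) * ennreal (H \<alpha> \<rho> \<gamma> \<delta> \<mu> \<nu> \<nu>t x (Suc n) * f x) \<partial>\<Lambda>)"
        using a_nonneg[of "Suc n"] f_nonneg profile_nn
        by (intro nn_integral_cong)
           (auto simp: H_eq space_\<Lambda> mult_ac less_imp_le simp flip: ennreal_mult)
      also have "\<dots> = ennreal (a (Suc n)) * A n"
        unfolding A_def by (rule nn_integral_cmult) measurable
      also have "ennreal (a (Suc n)) = ennreal (c n / w n) * ennreal (w n powr \<sigma>) * G n"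
        using a_nonneg[of "Suc n"] w_pos[of n] c_pos[of n]
        by (simp add: G_def powr_diff flip: ennreal_mult)
      finally show ?thesis by (simp add: mult_ac)
    qed
    then show ?thesis by (simp add: int_N TF)
  qed

  \<comment> \<open>It remains to apply the Schur test to \<open>l\<close> and to its transpose, and Hoelder's inequality on \<open>N\<close>.\<close>
  have root: "epowr X (1 / s) < \<kappa> * epowr Y (1 / s)" if "X < epowr \<kappa> s * Y" "s > 1" for X Y s
    using epowr_strict_mono[OF that(1), of "1 / s"] that(2) by (simp add: epowr_mult epowr_epowr)
  have J1_less: "epowr (\<integral>\<^sup>+n. epowr (\<integral>\<^sup>+x. ennreal (l x n) * F x \<partial>M) p \<partial>N) (1 / p)
      < \<kappa> * wnorm_fun p (\<Phi> p \<sigma> \<delta> \<mu>) f"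
    unfolding F_norm
  proof (intro root p Schur_test_strict[OF sfM sfN L_MN])
    show "(\<forall>x\<in>space M. (\<integral>\<^sup>+n. ennreal (l x n) \<partial>N) < \<kappa>) \<or>
        (\<forall>n\<in>space N. (\<integral>\<^sup>+x. ennreal (l x n) \<partial>M) < \<kappa>) \<and>
        (\<forall>x\<in>space M. \<forall>n\<in>space N. 0 < ennreal (l x n)) \<and> \<not> (AE n in N. False)"
      using col by (auto simp: M_def space_\<Lambda>)
  qed (use F_int row col \<open>0 < \<kappa>\<close> \<open>\<kappa> < \<infinity>\<close> in \<open>auto simp: M_def space_\<Lambda> less_imp_le\<close>)
  have J2_less: "epowr (\<integral>\<^sup>+x. epowr (\<integral>\<^sup>+n. ennreal (l x n) * G n \<partial>N) q \<partial>M) (1 / q)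
      < \<kappa> * wnorm_seq q (\<Psi>t q \<sigma> \<nu> \<nu>t) a"
    unfolding G_norm
  proof (intro root q Schur_test_strict[OF sfN sfM L_NM])
    have "emeasure lebesgue {0<..1::real} \<le> emeasure lebesgue {0::real<..}"
      by (intro emeasure_mono) auto
    then have "\<not> (AE x in \<Lambda>. False)"
      unfolding \<Lambda>_def by (intro AE_lebesgue_on_False) auto
    moreover have \<mu>u_pos: "AE x in \<Lambda>. 0 < ennreal (\<mu> x / u x)"
      using \<mu>_pos u_pos by (intro AE_I2) (auto simp: space_\<Lambda>)
    ultimately have "\<not> (AE x in M. False)"
    proof (intro notI, elim notE)
      assume "AE x in M. False"
      then have "AE x in \<Lambda>. 0 < ennreal (\<mu> x / u x) \<longrightarrow> False"
        unfolding M_def by (rule AE_density[THEN iffD1, rotated]) measurable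
      then show "AE x in \<Lambda>. False" using \<mu>u_pos by (rule AE_mp[rotated])
    qed
    then show "(\<forall>n\<in>space N. (\<integral>\<^sup>+x. ennreal (l x n) \<partial>M) < \<kappa>) \<or>
        (\<forall>x\<in>space M. (\<integral>\<^sup>+n. ennreal (l x n) \<partial>N) < \<kappa>) \<and>
        (\<forall>n\<in>space N. \<forall>x\<in>space M. 0 < ennreal (l x n)) \<and> \<not> (AE x in M. False)"
      using col l_pos by (auto simp: M_def space_\<Lambda>)
  qed (use G_int row col \<open>0 < \<kappa>\<close> \<open>\<kappa> < \<infinity>\<close> in \<open>auto simp: M_def N_def space_\<Lambda> less_imp_le\<close>)
  have "(\<integral>\<^sup>+n. (\<integral>\<^sup>+x. ennreal (l x n) * F x \<partial>M) * G n \<partial>N)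
      \<le> epowr (\<integral>\<^sup>+n. epowr (\<integral>\<^sup>+x. ennreal (l x n) * F x \<partial>M) p \<partial>N) (1 / p)
         * wnorm_seq q (\<Psi>t q \<sigma> \<nu> \<nu>t) a"
    unfolding G_norm using p pq by (intro nn_integral_Hoelder) (auto simp: N_def)
  also have "\<dots> < \<kappa> * wnorm_fun p (\<Phi> p \<sigma> \<delta> \<mu>) f * wnorm_seq q (\<Psi>t q \<sigma> \<nu> \<nu>t) a"
    using J1_less assms(20,21) by (intro ennreal_mult_strict_right_mono) (auto simp: less_top)
  finally have I_less: "(\<integral>\<^sup>+n. (\<integral>\<^sup>+x. ennreal (l x n) * F x \<partial>M) * G n \<partial>N)
      < \<kappa> * wnorm_fun p (\<Phi> p \<sigma> \<delta> \<mu>) f * wnorm_seq q (\<Psi>t q \<sigma> \<nu> \<nu>t) a" .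
  show ?thesis
    using I_less J1_less J2_less
    unfolding I[symmetric] J1[symmetric] J2[symmetric] A_def B_def \<Lambda>_def \<kappa>_def u_def c_def w_def
    by blast
qed

end
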